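(* There exists a recursive universal quasiminimal $\mathbb{Z}$-subshift, i.e. a subshift $X \subset S^{\mathbb{Z}}$ for some finite alphabet $S$ which is recursive, universal and quasiminimal.
   Context: For a finite alphabet $S$, give $S^{\mathbb{Z}}$ the product topology and the shift $\sigma(x)_i = x_{i+1}$. A ($\mathbb{Z}$-)subshift is a closed set $X \subset S^{\mathbb{Z}}$ with $\sigma(X)=X$; a subshift of $X$ is a subshift $Y \subset X$. $X$ is quasiminimal if it has finitely many proper subshifts. The language $\mathcal{L}(X) \subset S^*$ is the set of all finite words occurring as contiguous subwords of points of $X$. $X$ is recursive if $\mathcal{L}(X)$ is recursive. The model-checking problem of $X$ for finite-state automata is to decide, given a finite-state automaton recognizing a regular language $L \subset S^*$, whether $\mathcal{L}(X) \cap L \neq \emptyset$. $X$ is universal if this problem is $\Sigma^0_1$-complete (under many-one reductions). *)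

theory Defs
  imports "HOL-Analysis.Function_Topology" "HOL-Library.Nat_Bijection"
begin

section \<open>Subshifts\<close>

definition shift :: "(int \<Rightarrow> 'a) \<Rightarrow> int \<Rightarrow> 'a" where
  "shift x = (\<lambda>i. x (i + 1))"

text \<open>The topological space below has underlying set \<open>UNIV \<rightarrow>\<^sub>E S\<close>, so \<open>closedin\<close> entails
  that all points of \<open>X\<close> take values in \<open>S\<close>. The empty subshift is allowed.\<close>

definition subshift :: "'a set \<Rightarrow> (int \<Rightarrow> 'a) set \<Rightarrow> bool" where
  "subshift S X \<longleftrightarrow>
     closedin (product_topology (\<lambda>_::int. discrete_topology S) UNIV) X \<and> shift ` X = X"

definition quasiminimal :: "'a set \<Rightarrow> (int \<Rightarrow> 'a) set \<Rightarrow> bool" where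
  "quasiminimal S X \<longleftrightarrow> finite {Y. subshift S Y \<and> Y \<subset> X}"

text \<open>If \<open>j < i\<close> then \<open>[i..j]\<close> is empty, which contributes the empty word.\<close>

definition language :: "(int \<Rightarrow> 'a) set \<Rightarrow> 'a list set" where
  "language X = {map x [i..j] | x i j. x \<in> X}"


section \<open>Recursive functions and sets\<close>

datatype recf =
    Zero
  | Succ
  | Proj nat
  | Comp recf "recf list"
  | PrimRec recf recf
  | Mu recf

text \<open>\<open>rec_eval f xs y\<close>: the \<open>\<mu>\<close>-recursive function denoted by \<open>f\<close> is defined at \<open>xs\<close> with
  value \<open>y\<close>. Terms carry no arity: at each fixed length of \<open>xs\<close> a term denotes a partial
  recursive function of that arity, being undefined where arities do not match. In \<open>PrimRec\<close> and
  \<open>Mu\<close> the variable of recursion, respectively of minimisation, is the first argument.\<close>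

inductive rec_eval :: "recf \<Rightarrow> nat list \<Rightarrow> nat \<Rightarrow> bool" where
  zero: "rec_eval Zero xs 0"
| succ: "rec_eval Succ [x] (Suc x)"
| proj: "i < length xs \<Longrightarrow> rec_eval (Proj i) xs (xs ! i)"
| comp: "list_all2 (\<lambda>g y. rec_eval g xs y) gs ys \<Longrightarrow> rec_eval f ys z
         \<Longrightarrow> rec_eval (Comp f gs) xs z"
| primrec_0: "rec_eval f xs y \<Longrightarrow> rec_eval (PrimRec f g) (0 # xs) y"
| primrec_Suc: "rec_eval (PrimRec f g) (n # xs) r \<Longrightarrow> rec_eval g (n # r # xs) y
         \<Longrightarrow> rec_eval (PrimRec f g) (Suc n # xs) y"
| mu: "rec_eval f (n # xs) 0 \<Longrightarrow> (\<And>m. m < n \<Longrightarrow> \<exists>k. rec_eval f (m # xs) (Suc k))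
         \<Longrightarrow> rec_eval (Mu f) xs n"

lemma rec_eval_deterministic:
  "rec_eval f xs y \<Longrightarrow> rec_eval f xs z \<Longrightarrow> y = z"
proof (induction arbitrary: z rule: rec_eval.induct)
  case (comp xs gs ys f z')
  from comp.prems obtain ys' where *: "list_all2 (\<lambda>g y. rec_eval g xs y) gs ys'" "rec_eval f ys' z"
    by (auto elim: rec_eval.cases)
  have "ys = ys'"
    using comp.IH(1) *(1) by (auto simp: list_all2_conv_all_nth intro!: nth_equalityI)
  then show ?case using comp.IH(2) *(2) by blast
next
  case (primrec_0 f xs y g)
  from primrec_0.prems show ?case by cases (auto dest: primrec_0.IH)
next
  case (primrec_Suc f g n xs r y)
  from primrec_Suc.prems show ?case by cases (auto dest!: primrec_Suc.IH)
next
  case (mu f n xs)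
  from mu.prems obtain *: "rec_eval f (z # xs) 0"
    "\<And>m. m < z \<Longrightarrow> \<exists>k. rec_eval f (m # xs) (Suc k)"
    by cases auto
  show ?case
    using mu.IH *  by (metis nat.distinct(1) nat_neq_iff)
qed (auto elim: rec_eval.cases)

definition recursive_fun :: "nat \<Rightarrow> (nat list \<Rightarrow> nat) \<Rightarrow> bool" where
  "recursive_fun k f \<longleftrightarrow> (\<exists>p. \<forall>xs. length xs = k \<longrightarrow> rec_eval p xs (f xs))"

definition recursive_pred :: "nat \<Rightarrow> (nat list \<Rightarrow> bool) \<Rightarrow> bool" where
  "recursive_pred k P \<longleftrightarrow> recursive_fun k (\<lambda>xs. of_bool (P xs))"

definition recursive_set :: "nat set \<Rightarrow> bool" where
  "recursive_set A \<longleftrightarrow> recursive_pred 1 (\<lambda>xs. xs ! 0 \<in> A)"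

definition sigma01 :: "nat set \<Rightarrow> bool" where
  "sigma01 A \<longleftrightarrow> (\<exists>R. recursive_pred 2 R \<and> A = {n. \<exists>m. R [n, m]})"

definition many_one_reducible :: "nat set \<Rightarrow> nat set \<Rightarrow> bool" where
  "many_one_reducible A B \<longleftrightarrow>
     (\<exists>f. recursive_fun 1 (\<lambda>xs. f (xs ! 0)) \<and> (\<forall>n. n \<in> A \<longleftrightarrow> f n \<in> B))"

definition sigma01_complete :: "nat set \<Rightarrow> bool" where
  "sigma01_complete B \<longleftrightarrow> sigma01 B \<and> (\<forall>A. sigma01 A \<longrightarrow> many_one_reducible A B)"

text \<open>Words over a finite set of natural numbers are coded by the bijection \<open>list_encode\<close>.\<close>

definition recursive_language :: "nat list set \<Rightarrow> bool" where
  "recursive_language W \<longleftrightarrow> recursive_set (list_encode ` W)"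

definition recursive_subshift :: "(int \<Rightarrow> nat) set \<Rightarrow> bool" where
  "recursive_subshift X \<longleftrightarrow> recursive_language (language X)"


section \<open>Finite-state automata and model checking\<close>

text \<open>Nondeterministic automata without silent transitions. The states are the numbers below
  \<open>num_states\<close>, and a transition \<open>(p, a, q)\<close> leads from \<open>p\<close> to \<open>q\<close> reading \<open>a\<close>.\<close>

datatype nfa =
  NFA (num_states: nat) (start: nat) (final: "nat list") (transitions: "(nat \<times> nat \<times> nat) list")

definition nfa_over :: "nat set \<Rightarrow> nfa \<Rightarrow> bool" where
  "nfa_over S M \<longleftrightarrow>
     start M < num_states M \<and> set (final M) \<subseteq> {..<num_states M} \<and>
     set (transitions M) \<subseteq> {..<num_states M} \<times> S \<times> {..<num_states M}"

primrec nfa_accepts_from :: "nfa \<Rightarrow> nat \<Rightarrow> nat list \<Rightarrow> bool" where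
  "nfa_accepts_from M p [] \<longleftrightarrow> p \<in> set (final M)"
| "nfa_accepts_from M p (a # w) \<longleftrightarrow>
     (\<exists>q. (p, a, q) \<in> set (transitions M) \<and> nfa_accepts_from M q w)"

definition nfa_language :: "nfa \<Rightarrow> nat list set" where
  "nfa_language M = {w. nfa_accepts_from M (start M) w}"

definition nfa_code :: "nfa \<Rightarrow> nat" where
  "nfa_code M = list_encode
     [num_states M, start M, list_encode (final M),
      list_encode (map (\<lambda>(p, a, q). list_encode [p, a, q]) (transitions M))]"

definition model_checking_problem :: "nat set \<Rightarrow> (int \<Rightarrow> nat) set \<Rightarrow> nat set" where
  "model_checking_problem S X =
     nfa_code ` {M. nfa_over S M \<and> language X \<inter> nfa_language M \<noteq> {}}"

lemma inj_nfa_code: "inj nfa_code"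
proof (rule injI)
  fix M N assume "nfa_code M = nfa_code N"
  moreover have "inj (map (\<lambda>(p, a, q). list_encode [p, a, q]))"
    by (auto intro!: injI inj_mapI simp: list_encode_eq)
  ultimately show "M = N"
    by (auto simp: nfa_code_def list_encode_eq dest: injD intro: nfa.expand)
qed

definition universal_subshift :: "nat set \<Rightarrow> (int \<Rightarrow> nat) set \<Rightarrow> bool" where
  "universal_subshift S X \<longleftrightarrow> sigma01_complete (model_checking_problem S X)"

end

theory Submission
  imports Defs "HOL-Library.Sublist"
begin

text \<open>The subshift consists of the points all of whose factors occur in one of the words
  \<open>w\<^sub>0 = 1\<close>, \<open>w\<^sub>n\<^sub>+\<^sub>1 = w\<^sub>n 0\<^bsup>s(n)\<^esup> w\<^sub>n\<close>, for a suitable computable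
  function \<open>s\<close> with \<open>s(n) \<ge> n\<close>.

  \<^item> It is quasiminimal for every such \<open>s\<close>. Every 1 in a later word lies in a copy of
    \<open>w\<^sub>n\<close>, so a point with a single 1 already contains all \<open>w\<^sub>n\<close> and has a dense orbit
    (\<open>tower_occurs\<close>). The only proper subsystems are the empty one and the constant point 0.

  \<^item> It is recursive for every computable such \<open>s\<close>. For words of length \<open>n\<close>, the spacers from
    stage \<open>n\<close> on are as good as infinite, so these words can be found in
    \<open>0\<^bsup>n\<^esup> w\<^sub>n 0\<^bsup>n\<^esup>\<close> (\<open>tower_language_decision\<close>). It follows that the
    model-checking problem is semidecidable.

  \<^item> The words \<open>1 0\<^bsup>a\<^esup> 1\<close> in the language are those with \<open>a\<close> in the range of
    \<open>s\<close> (\<open>gap_in_tower_language\<close>). Hence whatever is coded decidably, stage by stage, in the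
    numbers \<open>s(n)\<close> becomes an existential question about the language. Let stage \<open>n\<close> code a pair
    \<open>(k, t)\<close> and let \<open>s(n)\<close> have 2-adic valuation \<open>k + 1\<close> if \<open>t\<close> witnesses that the
    \<open>k\<close>-th instance of a universal semidecidable problem is positive, and valuation 0 otherwise. An
    automaton that counts zeros modulo \<open>2\<^bsup>k+2\<^esup>\<close> accepts the words \<open>1 0\<^bsup>a\<^esup> 1\<close> with
    \<open>a\<close> of valuation \<open>k + 1\<close>, so it meets the language if and only if the instance is positive.

  What remains is computability theory for the terms \<open>recf\<close>: a calculus for proving functions on
  coded data computable (\<open>computable_intros\<close>), and a universal semidecidable relation, given by
  derivations in the evaluation relation (\<open>universal_step_universal\<close>).\<close>


section \<open>Computable functions between coded types\<close>

text \<open>All data of the construction (words, automata, derivations) get number codes, chosen so that the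
  codes of lists of numbers and of pairs are \<open>list_encode\<close> and \<open>prod_encode\<close>. A function between
  coded types is computable if some term of \<open>recf\<close> tracks it on codes. Since several arguments can
  be packed into a tuple, unary functions suffice, and closure under the usual program constructs can be
  stated as introduction rules for \<open>\<lambda>\<close>-abstractions over an environment: the bound variables of
  a loop body or of a case branch are the components of a nested pair.\<close>

class coded =
  fixes code :: "'a \<Rightarrow> nat"
  assumes inj_code: "inj code"

lemma code_eq_iff [simp]: "code x = code y \<longleftrightarrow> x = y"
  using inj_code by (auto dest: injD)

instantiation nat :: coded
begin
definition code_nat [simp]: "code (n :: nat) = n"
instance by standard (simp add: inj_def)
end

instantiation bool :: coded
begin
definition code_bool [simp]: "code (b :: bool) = of_bool b"
instance by standard (auto simp: inj_def split: if_splits)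
end

instantiation prod :: (coded, coded) coded
begin
definition code_prod [simp]: "code p = prod_encode (code (fst p), code (snd p))"
instance by standard (auto simp: inj_def prod_encode_eq)
end

instantiation list :: (coded) coded
begin
definition code_list: "code xs = list_encode (map code xs)"
instance by standard (auto simp: inj_def code_list list_encode_eq intro: list.inj_map_strong)
end

lemma code_Nil [simp]: "code [] = 0"
  and code_Cons [simp]: "code (x # xs) = Suc (prod_encode (code x, code xs))"
  by (simp_all add: code_list)

lemma code_nat_list: "code (xs :: nat list) = list_encode xs"
  by (simp add: code_list map_idI)

text \<open>Where every number is a code, decoding is total, and it is computable by the identity. This is
  what allows a quantifier over numbers to range over, say, lists of triples.\<close>

class bijectively_coded = coded +
  assumes surj_code: "surj code"

instance nat :: bijectively_coded
  by standard (simp add: surj_def)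

instance prod :: (bijectively_coded, bijectively_coded) bijectively_coded
proof (standard, rule surjI)
  fix n
  show "code (inv code (fst (prod_decode n)) :: 'a, inv code (snd (prod_decode n)) :: 'b) = n"
    by (simp add: surj_f_inv_f[OF surj_code])
qed

instance list :: (bijectively_coded) bijectively_coded
proof (standard, rule surjI)
  fix n
  show "code (map (inv code) (list_decode n) :: 'a list) = n"
    by (simp add: code_list surj_f_inv_f[OF surj_code] comp_def)
qed

definition decode :: "nat \<Rightarrow> 'a :: bijectively_coded" where
  "decode = inv code"

lemma code_decode [simp]: "code (decode n) = n"
  by (simp add: decode_def surj_f_inv_f[OF surj_code])

lemma decode_code [simp]: "decode (code x) = x"
  by (simp add: decode_def inv_f_f[OF inj_code])

definition computable :: "('a :: coded \<Rightarrow> 'b :: coded) \<Rightarrow> bool" where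
  "computable f \<longleftrightarrow> (\<exists>p. \<forall>x. rec_eval p [code x] (code (f x)))"

lemma computableI: "(\<And>x. rec_eval p [code x] (code (f x))) \<Longrightarrow> computable f"
  by (auto simp: computable_def)

lemma computableE:
  assumes "computable f"
  obtains p where "\<And>x. rec_eval p [code x] (code (f x))"
  using assms by (auto simp: computable_def)


subsection \<open>Arithmetic underlying the pairing function\<close>

lemma rec_eval_Proj: "i < length xs \<Longrightarrow> y = xs ! i \<Longrightarrow> rec_eval (Proj i) xs y"
  by (simp add: rec_eval.proj)

lemma rec_eval_Comp1:
  "rec_eval g xs a \<Longrightarrow> rec_eval f [a] z \<Longrightarrow> rec_eval (Comp f [g]) xs z"
  by (rule rec_eval.comp[of _ _ "[a]"]) auto

lemma rec_eval_Comp2: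
  "rec_eval g xs a \<Longrightarrow> rec_eval h xs b \<Longrightarrow> rec_eval f [a, b] z \<Longrightarrow> rec_eval (Comp f [g, h]) xs z"
  by (rule rec_eval.comp[of _ _ "[a, b]"]) auto

text \<open>A recursion can be evaluated by guessing its values \<open>h\<close> and checking the two equations.\<close>

lemma rec_eval_PrimRec:
  assumes "rec_eval f xs (h 0)" "\<And>n. rec_eval g (n # h n # xs) (h (Suc n))"
  shows "rec_eval (PrimRec f g) (n # xs) (h n)"
  by (induction n) (auto intro: rec_eval.intros assms)

lemma ex_rec_const: "\<exists>p. \<forall>xs. rec_eval p xs n"
proof (induction n)
  case 0
  show ?case by (blast intro: rec_eval.zero)
next
  case (Suc n)
  then obtain p where "\<forall>xs. rec_eval p xs n" ..
  then show ?case by (intro exI[of _ "Comp Succ [p]"]) (blast intro: rec_eval_Comp1 rec_eval.succ)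
qed

lemma ex_rec_add: "\<exists>p. \<forall>m n. rec_eval p [m, n] (m + n)"
proof (intro exI allI)
  fix m n
  show "rec_eval (PrimRec (Proj 0) (Comp Succ [Proj 1])) [m, n] (m + n)"
    by (rule rec_eval_PrimRec)
      (auto intro!: rec_eval_Comp1[of _ _ "_ + n"] rec_eval_Proj rec_eval.succ)
qed

lemma ex_rec_pred: "\<exists>p. \<forall>n. rec_eval p [n] (n - 1)"
proof (intro exI allI)
  fix n :: nat
  show "rec_eval (PrimRec Zero (Proj 0)) [n] (n - 1)"
    by (rule rec_eval_PrimRec) (auto intro!: rec_eval_Proj rec_eval.zero)
qed

lemma ex_rec_diff: "\<exists>p. \<forall>m n. rec_eval p [n, m] (m - n)"
proof -
  obtain p where p: "\<And>n. rec_eval p [n] (n - 1)" using ex_rec_pred by blast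
  show ?thesis
  proof (intro exI allI)
    fix m n :: nat
    show "rec_eval (PrimRec (Proj 0) (Comp p [Proj 1])) [n, m] (m - n)"
    proof (rule rec_eval_PrimRec)
      fix n show "rec_eval (Comp p [Proj 1]) [n, m - n, m] (m - Suc n)"
        using p[of "m - n"] by (auto intro!: rec_eval_Comp1[of _ _ "m - n"] rec_eval_Proj)
    qed (auto intro: rec_eval_Proj)
  qed
qed

lemma ex_rec_triangle: "\<exists>p. \<forall>n. rec_eval p [n] (triangle n)"
proof -
  obtain p where p: "\<And>m n. rec_eval p [m, n] (m + n)" using ex_rec_add by blast
  show ?thesis
  proof (intro exI allI)
    fix n :: nat
    show "rec_eval (PrimRec Zero (Comp p [Proj 1, Comp Succ [Proj 0]])) [n] (triangle n)"
      proof (rule rec_eval_PrimRec)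
      fix n
      show "rec_eval (Comp p [Proj 1, Comp Succ [Proj 0]]) [n, triangle n] (triangle (Suc n))"
        unfolding triangle_Suc
        by (rule rec_eval_Comp2[OF _ rec_eval_Comp1[OF _ rec_eval.succ] p]; simp add: rec_eval_Proj)
    qed (simp add: rec_eval.zero)
  qed
qed

lemma ex_rec_prod_encode: "\<exists>p. \<forall>m n. rec_eval p [m, n] (prod_encode (m, n))"
proof -
  obtain p where p: "\<And>m n. rec_eval p [m, n] (m + n)" using ex_rec_add by blast
  obtain q where q: "\<And>n. rec_eval q [n] (triangle n)" using ex_rec_triangle by blast
  show ?thesis
  proof (intro exI allI)
    fix m n :: nat
    show "rec_eval (Comp p [Comp q [p], Proj 0]) [m, n] (prod_encode (m, n))"
      unfolding prod_encode_def prod.case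
      by (rule rec_eval_Comp2[OF _ _ p] rec_eval_Comp1[OF _ q] p)+ (simp add: rec_eval_Proj)
  qed
qed

text \<open>The diagonal on which a pair lies is the least \<open>s\<close> with
  \<open>n < triangle (s + 1)\<close>, so unbounded search recovers both components.\<close>

lemma Least_triangle:
  "(LEAST s. Suc (prod_encode (a, b)) - triangle (Suc s) = 0) = a + b"
proof (rule Least_equality)
  show "Suc (prod_encode (a, b)) - triangle (Suc (a + b)) = 0"
    by (simp add: prod_encode_def)
next
  fix s assume *: "Suc (prod_encode (a, b)) - triangle (Suc s) = 0"
  have mono: "triangle m \<le> triangle n" if "m \<le> n" for m n
    using that by (induction rule: dec_induct) auto
  show "a + b \<le> s"
    using * mono[of "Suc s" "a + b"] by (force simp: prod_encode_def not_le[symmetric])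
qed

lemma ex_rec_prod_decode:
  "\<exists>p q. \<forall>a b. rec_eval p [prod_encode (a, b)] a \<and> rec_eval q [prod_encode (a, b)] b"
proof -
  obtain d where d: "\<And>m n. rec_eval d [n, m] (m - n)" using ex_rec_diff by blast
  obtain tri where tri: "\<And>n. rec_eval tri [n] (triangle n)" using ex_rec_triangle by blast
  define diag where "diag = Mu (Comp d [Comp tri [Comp Succ [Proj 0]], Comp Succ [Proj 1]])"
  define p where "p = Comp d [Comp tri [diag], Proj 0]"
  define q where "q = Comp d [p, diag]"
  have "rec_eval p [prod_encode (a, b)] a \<and> rec_eval q [prod_encode (a, b)] b" for a b
  proof -
    let ?n = "prod_encode (a, b)"
    let ?d = "Comp d [Comp tri [Comp Succ [Proj 0]], Comp Succ [Proj 1]]"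
    have ev: "rec_eval ?d [s, ?n] (Suc ?n - triangle (Suc s))" for s
      by (rule rec_eval_Comp2[OF rec_eval_Comp1[OF rec_eval_Comp1[OF _ rec_eval.succ] tri]
            rec_eval_Comp1[OF _ rec_eval.succ] d]; simp add: rec_eval_Proj)
    have "rec_eval diag [?n] (LEAST s. Suc ?n - triangle (Suc s) = 0)"
      unfolding diag_def
    proof (rule rec_eval.mu)
      let ?P = "\<lambda>s. Suc ?n - triangle (Suc s) = 0"
      have "?P (a + b)" by (simp add: prod_encode_def)
      then have "?P (LEAST s. ?P s)" by (rule LeastI)
      then show "rec_eval ?d [LEAST s. ?P s, ?n] 0" using ev[of "LEAST s. ?P s"] by simp
      fix m assume "m < (LEAST s. ?P s)"
      then have "\<not> ?P m" by (rule not_less_Least)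
      then show "\<exists>k. rec_eval ?d [m, ?n] (Suc k)" using ev[of m] by (metis not0_implies_Suc)
    qed
    then have diag: "rec_eval diag [?n] (a + b)" by (simp only: Least_triangle)
    have "rec_eval p [?n] (?n - triangle (a + b))"
      unfolding p_def
      by (auto intro!: rec_eval_Comp2[OF _ _ d] rec_eval_Comp1[OF diag tri] rec_eval_Proj)
    then have p: "rec_eval p [?n] a" by (simp add: prod_encode_def)
    have "rec_eval q [?n] (a + b - a)"
      unfolding q_def by (rule rec_eval_Comp2[OF p diag d])
    with p show ?thesis by simp
  qed
  then show ?thesis by blast
qed


subsection \<open>Closure properties\<close>

named_theorems computable_intros

lemma computable_id [computable_intros]: "computable (\<lambda>x. x)"
  by (rule computableI[of "Proj 0"]) (simp add: rec_eval_Proj)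

lemma computable_const [computable_intros]: "computable (\<lambda>x. c)"
  using ex_rec_const[of "code c"] by (auto simp: computable_def)

lemma computable_comp:
  assumes "computable f" "computable g"
  shows "computable (\<lambda>x. f (g x))"
proof -
  obtain p q where "\<And>x. rec_eval p [code x] (code (f x))" "\<And>x. rec_eval q [code x] (code (g x))"
    using assms by (auto elim!: computableE)
  then show ?thesis
    by (intro computableI[of "Comp p [q]"]) (blast intro: rec_eval_Comp1)
qed

lemma computable_Pair [computable_intros]:
  assumes "computable f" "computable g"
  shows "computable (\<lambda>x. (f x, g x))"
proof -
  obtain p q where *: "\<And>x. rec_eval p [code x] (code (f x))" "\<And>x. rec_eval q [code x] (code (g x))"
    using assms by (auto elim!: computableE)
  obtain r where r: "\<And>m n. rec_eval r [m, n] (prod_encode (m, n))" using ex_rec_prod_encode by blast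
  have "rec_eval (Comp r [p, q]) [code x] (code (f x, g x))" for x
    using rec_eval_Comp2[OF *[of x] r] by simp
  then show ?thesis by (rule computableI)
qed

lemma computable_fst [computable_intros]: "computable f \<Longrightarrow> computable (\<lambda>x. fst (f x))"
  and computable_snd [computable_intros]: "computable f \<Longrightarrow> computable (\<lambda>x. snd (f x))"
proof -
  obtain p q where "\<And>a b. rec_eval p [prod_encode (a, b)] a" "\<And>a b. rec_eval q [prod_encode (a, b)] b"
    using ex_rec_prod_decode by blast
  then have "computable (fst :: 'b \<times> 'c \<Rightarrow> 'b)" "computable (snd :: 'b \<times> 'c \<Rightarrow> 'c)"
    by (auto intro!: computableI)
  then show "computable f \<Longrightarrow> computable (\<lambda>x. fst (f x))" "computable f \<Longrightarrow> computable (\<lambda>x. snd (f x))"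
    by (blast intro: computable_comp)+
qed

text \<open>Functions which do not change codes are computable.\<close>

lemma computable_recode:
  assumes "computable f" "\<And>x. code (h x) = code (f x)"
  shows "computable h"
  using assms by (auto simp: computable_def)

lemma computable_code [computable_intros]: "computable f \<Longrightarrow> computable (\<lambda>x. code (f x))"
  by (erule computable_recode) simp

lemma computable_decode [computable_intros]:
  "computable f \<Longrightarrow> computable (\<lambda>x. decode (f x))"
  by (erule computable_recode) simp

lemma computable_Suc [computable_intros]: "computable f \<Longrightarrow> computable (\<lambda>x. Suc (f x))"
proof -
  have "computable Suc" by (rule computableI[of Succ]) (simp add: rec_eval.succ)
  then show "computable f \<Longrightarrow> ?thesis" by (rule computable_comp)
qed

lemma computable_funpow [computable_intros]:
  fixes step :: "'e :: coded \<Rightarrow> 's :: coded \<Rightarrow> 's"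
  assumes n: "computable n" and s: "computable s"
    and step: "computable (\<lambda>p. step (fst p) (snd p))"
  shows "computable (\<lambda>e. (step e ^^ n e) (s e))"
proof -
  obtain pn ps where pn: "\<And>e. rec_eval pn [code e] (n e)"
    and ps: "\<And>e. rec_eval ps [code e] (code (s e))"
    using n s unfolding computable_def by auto
  obtain g where g: "\<And>e x. rec_eval g [prod_encode (code e, code x)] (code (step e x))"
    using step by (elim computableE) fastforce
  obtain r where r: "\<And>m n. rec_eval r [m, n] (prod_encode (m, n))" using ex_rec_prod_encode by blast
  let ?G = "Comp g [Comp r [Proj 2, Proj 1]]"
  have "rec_eval (PrimRec ps ?G) [k, code e] (code ((step e ^^ k) (s e)))" for k e
  proof (rule rec_eval_PrimRec)
    fix k
    have Suc: "(step e ^^ Suc k) (s e) = step e ((step e ^^ k) (s e))" by simp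
    show "rec_eval ?G [k, code ((step e ^^ k) (s e)), code e] (code ((step e ^^ Suc k) (s e)))"
      unfolding Suc
      by (rule rec_eval_Comp1[OF rec_eval_Comp2[OF _ _ r] g]; simp add: rec_eval_Proj)
  qed (simp add: ps)
  then have "rec_eval (Comp (PrimRec ps ?G) [pn, Proj 0]) [code e] (code ((step e ^^ n e) (s e)))" for e
    by (blast intro: rec_eval_Comp2[OF pn] rec_eval_Proj[of 0 "[code e]" "code e", simplified])
  then show ?thesis by (rule computableI)
qed

text \<open>Case distinction is a primitive recursion that ignores its previous value. That value must still
  be defined, which it is since both branches are total on all natural numbers.\<close>

lemma computable_case_nat [computable_intros]:
  assumes n: "computable n" and f: "computable f" and g: "computable (\<lambda>p. g (fst p) (snd p))"
  shows "computable (\<lambda>e. case n e of 0 \<Rightarrow> f e | Suc m \<Rightarrow> g e m)"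
proof -
  obtain pn pf where pn: "\<And>e. rec_eval pn [code e] (n e)"
    and pf: "\<And>e. rec_eval pf [code e] (code (f e))"
    using n f unfolding computable_def by auto
  obtain pg where pg: "\<And>e x. rec_eval pg [prod_encode (code e, x)] (code (g e x))"
    using g by (elim computableE) fastforce
  obtain r where r: "\<And>m n. rec_eval r [m, n] (prod_encode (m, n))" using ex_rec_prod_encode by blast
  let ?G = "Comp pg [Comp r [Proj 2, Proj 0]]"
  have "rec_eval (PrimRec pf ?G) [k, code e] (code (case k of 0 \<Rightarrow> f e | Suc m \<Rightarrow> g e m))" for k e
  proof (rule rec_eval_PrimRec)
    fix k
    show "rec_eval ?G [k, code (case k of 0 \<Rightarrow> f e | Suc m \<Rightarrow> g e m), code e]
        (code (case Suc k of 0 \<Rightarrow> f e | Suc m \<Rightarrow> g e m))"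
      unfolding nat.case
      by (rule rec_eval_Comp1[OF rec_eval_Comp2[OF _ _ r] pg]; simp add: rec_eval_Proj)
  qed (simp add: pf)
  then have "rec_eval (Comp (PrimRec pf ?G) [pn, Proj 0]) [code e]
      (code (case n e of 0 \<Rightarrow> f e | Suc m \<Rightarrow> g e m))" for e
    by (blast intro: rec_eval_Comp2[OF pn] rec_eval_Proj[of 0 "[code e]" "code e", simplified])
  then show ?thesis by (rule computableI)
qed

lemma computable_If [computable_intros]:
  assumes "computable b" "computable f" "computable g"
  shows "computable (\<lambda>e. if b e then f e else g e)"
proof -
  have "computable (\<lambda>e. of_bool (b e) :: nat)"
    using assms(1) by (rule computable_recode) simp
  then have "computable (\<lambda>e. case of_bool (b e) of 0 \<Rightarrow> g e | Suc m \<Rightarrow> f e)"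
    using assms by (intro computable_intros computable_comp[of f fst])
  moreover have "(\<lambda>e. case of_bool (b e) of 0 \<Rightarrow> g e | Suc m \<Rightarrow> f e) =
      (\<lambda>e. if b e then f e else g e)" by auto
  ultimately show ?thesis by simp
qed

lemma computable_not [computable_intros]: "computable b \<Longrightarrow> computable (\<lambda>e. \<not> b e)"
  using computable_If[of b "\<lambda>_. False" "\<lambda>_. True"]
  by (simp add: computable_const if_bool_eq_conj cong: if_cong)

lemma computable_conj [computable_intros]:
  "computable b \<Longrightarrow> computable c \<Longrightarrow> computable (\<lambda>e. b e \<and> c e)"
  using computable_If[of b c "\<lambda>_. False"]
  by (simp add: computable_const if_bool_eq_disj)

lemma computable_disj [computable_intros]:
  "computable b \<Longrightarrow> computable c \<Longrightarrow> computable (\<lambda>e. b e \<or> c e)"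
  using computable_If[of b "\<lambda>_. True" c]
  by (simp add: computable_const if_bool_eq_conj disj_commute imp_conv_disj)

lemma computable_diff [computable_intros]:
  fixes f g :: "_ \<Rightarrow> nat"
  assumes "computable f" "computable g"
  shows "computable (\<lambda>e. f e - g e)"
proof -
  have "((\<lambda>k. case k of 0 \<Rightarrow> 0 | Suc k \<Rightarrow> k) ^^ n) m = m - n" for m n :: nat
    by (induction n) (auto split: nat.split)
  moreover have "computable (\<lambda>e. ((\<lambda>k. case k of 0 \<Rightarrow> 0 | Suc k \<Rightarrow> k) ^^ g e) (f e))"
    by (intro computable_intros assms)
  ultimately show ?thesis by simp
qed

lemma computable_add [computable_intros]:
  fixes f g :: "_ \<Rightarrow> nat"
  assumes "computable f" "computable g"
  shows "computable (\<lambda>e. f e + g e)"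
proof -
  have "computable (\<lambda>e. (Suc ^^ g e) (f e))"
    by (intro computable_intros assms)
  then show ?thesis by (simp add: add.commute)
qed

lemma computable_mult [computable_intros]:
  fixes f g :: "_ \<Rightarrow> nat"
  assumes "computable f" "computable g"
  shows "computable (\<lambda>e. f e * g e)"
proof -
  have "((\<lambda>k. k + m) ^^ n) 0 = m * n" for m n :: nat
    by (induction n) auto
  moreover have "computable (\<lambda>e. ((\<lambda>k. k + f e) ^^ g e) 0)"
    by (intro computable_intros assms computable_comp[OF assms(1)])
  ultimately show ?thesis by simp
qed

lemma computable_power [computable_intros]:
  fixes f g :: "_ \<Rightarrow> nat"
  assumes "computable f" "computable g"
  shows "computable (\<lambda>e. f e ^ g e)"
proof -
  have "((\<lambda>k. k * m) ^^ n) 1 = m ^ n" for m n :: nat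
    by (induction n) auto
  moreover have "computable (\<lambda>e. ((\<lambda>k. k * f e) ^^ g e) 1)"
    by (intro computable_intros assms computable_comp[OF assms(1)])
  ultimately show ?thesis by simp
qed

lemma computable_le [computable_intros]:
  fixes f g :: "_ \<Rightarrow> nat"
  assumes "computable f" "computable g"
  shows "computable (\<lambda>e. f e \<le> g e)"
proof -
  have "computable (\<lambda>e. case f e - g e of 0 \<Rightarrow> True | Suc _ \<Rightarrow> False)"
    by (intro computable_intros assms)
  moreover have "(case m - n of 0 \<Rightarrow> True | Suc _ \<Rightarrow> False) \<longleftrightarrow> m \<le> n" for m n :: nat
    by (auto split: nat.split)
  ultimately show ?thesis by simp
qed

lemma computable_less [computable_intros]:
  fixes f g :: "_ \<Rightarrow> nat"
  shows "computable f \<Longrightarrow> computable g \<Longrightarrow> computable (\<lambda>e. f e < g e)"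
  unfolding less_eq_Suc_le by (intro computable_intros)

lemma computable_eq [computable_intros]:
  assumes "computable f" "computable g"
  shows "computable (\<lambda>e. f e = g e)"
proof -
  have "computable (\<lambda>e. code (f e) \<le> code (g e) \<and> code (g e) \<le> code (f e))"
    by (intro computable_intros assms)
  then show ?thesis by (simp flip: order.eq_iff)
qed


subsection \<open>Lists\<close>

lemma computable_Cons [computable_intros]:
  assumes "computable f" "computable g"
  shows "computable (\<lambda>e. f e # g e)"
proof -
  have "computable (\<lambda>e. Suc (code (f e, g e)))" by (intro computable_intros assms)
  then show ?thesis by (rule computable_recode) simp
qed

text \<open>Head and tail are read off the code of a non-empty list. The head of the empty list is sent to
  an arbitrary value of the element type, since programs need only behave well on codes.\<close>

lemma computable_hd_tl:
  fixes l :: "'e :: coded \<Rightarrow> 'a :: coded list"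
  assumes l: "computable l"
  shows "computable (\<lambda>e. case l e of [] \<Rightarrow> undefined | x # xs \<Rightarrow> x)"
    and "computable (\<lambda>e. tl (l e))"
proof -
  let ?split = "decode :: nat \<Rightarrow> nat \<times> nat"
  have split: "?split (prod_encode (m, n)) = (m, n)" for m n
    using decode_code[of "(m, n)"] by simp
  have "computable (\<lambda>e. case code (l e) of 0 \<Rightarrow> code (undefined :: 'a) | Suc m \<Rightarrow> fst (?split m))"
    by (intro computable_intros l)
  then show "computable (\<lambda>e. case l e of [] \<Rightarrow> undefined | x # xs \<Rightarrow> x)"
    by (rule computable_recode) (auto simp: split split: list.split)
  have "computable (\<lambda>e. case code (l e) of 0 \<Rightarrow> 0 | Suc m \<Rightarrow> snd (?split m))"
    by (intro computable_intros l)
  then show "computable (\<lambda>e. tl (l e))"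
    by (rule computable_recode) (auto simp: split tl_def split: list.split)
qed

lemmas computable_tl [computable_intros] = computable_hd_tl(2)

lemma computable_case_list [computable_intros]:
  assumes l: "computable l" and f: "computable f"
    and g: "computable (\<lambda>p. g (fst p) (fst (snd p)) (snd (snd p)))"
  shows "computable (\<lambda>e. case l e of [] \<Rightarrow> f e | x # xs \<Rightarrow> g e x xs)"
proof -
  let ?hd = "\<lambda>e. case l e of [] \<Rightarrow> undefined | x # xs \<Rightarrow> x"
  have "computable (\<lambda>e. g e (?hd e) (tl (l e)))"
    using computable_comp[OF g, of "\<lambda>e. (e, ?hd e, tl (l e))"]
    by (simp add: computable_intros computable_hd_tl l)
  then have "computable (\<lambda>e. if l e = [] then f e else g e (?hd e) (tl (l e)))"
    by (intro computable_intros l f)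
  moreover have "(\<lambda>e. if l e = [] then f e else g e (?hd e) (tl (l e))) =
      (\<lambda>e. case l e of [] \<Rightarrow> f e | x # xs \<Rightarrow> g e x xs)"
    by (auto split: list.split)
  ultimately show ?thesis by simp
qed

text \<open>A fold consumes one element per step and idles at the empty list. The code of a list is at
  least its length, so iterating as many times as the code says is enough.\<close>

lemma length_le_code: "length xs \<le> code xs"
proof (induction xs)
  case (Cons x xs)
  then show ?case using le_prod_encode_2[of "code xs" "code x"] by simp
qed simp

lemma computable_foldl [computable_intros]:
  assumes a: "computable a" and l: "computable l"
    and f: "computable (\<lambda>p. f (fst p) (fst (snd p)) (snd (snd p)))"
  shows "computable (\<lambda>e. foldl (f e) (a e) (l e))"
proof -
  define step where "step f s = (case snd s of [] \<Rightarrow> s | x # xs \<Rightarrow> (f (fst s) x, xs))"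
    for f :: "'b \<Rightarrow> 'c \<Rightarrow> 'b" and s
  have nil: "(step f ^^ n) (b, []) = (b, [])" for f n b
    by (induction n) (auto simp: step_def)
  have *: "(step f ^^ n) (b, xs) = (foldl f b xs, [])" if "length xs \<le> n" for f n b xs
    using that
  proof (induction xs arbitrary: b n)
    case (Cons x xs)
    then obtain m where m: "n = Suc m" "length xs \<le> m" by (cases n) auto
    have "(step f ^^ n) (b, x # xs) = (step f ^^ m) (f b x, xs)"
      unfolding m funpow_Suc_right by (simp add: step_def)
    then show ?case using Cons.IH[OF m(2)] by simp
  qed (simp add: nil)
  have "computable (\<lambda>e. fst ((step (f e) ^^ code (l e)) (a e, l e)))"
    unfolding step_def
    by (intro computable_intros a l computable_comp[OF f, of "\<lambda>p. (_ p, _ p, _ p)", simplified])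
  then show ?thesis by (simp add: * length_le_code)
qed

lemma computable_rev [computable_intros]:
  assumes "computable l"
  shows "computable (\<lambda>e. rev (l e))"
proof -
  have "foldl (\<lambda>acc x. x # acc) ys xs = rev xs @ ys" for xs ys :: "'b list"
    by (induction xs arbitrary: ys) auto
  moreover have "computable (\<lambda>e. foldl (\<lambda>acc x. x # acc) [] (l e))"
    by (intro computable_intros assms)
  ultimately show ?thesis by simp
qed

lemma computable_append [computable_intros]:
  assumes "computable k" "computable l"
  shows "computable (\<lambda>e. k e @ l e)"
proof -
  have "foldl (\<lambda>acc x. x # acc) ys xs = rev xs @ ys" for xs ys :: "'b list"
    by (induction xs arbitrary: ys) auto
  moreover have "computable (\<lambda>e. foldl (\<lambda>acc x. x # acc) (l e) (rev (k e)))"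
    by (intro computable_intros assms)
  ultimately show ?thesis by simp
qed

lemma computable_map [computable_intros]:
  assumes "computable l" and f: "computable (\<lambda>p. f (fst p) (snd p))"
  shows "computable (\<lambda>e. map (f e) (l e))"
proof -
  have "foldl (\<lambda>acc x. acc @ [f x]) ys xs = ys @ map f xs" for f :: "'b \<Rightarrow> 'c" and xs ys
    by (induction xs arbitrary: ys) auto
  moreover have "computable (\<lambda>e. foldl (\<lambda>acc x. acc @ [f e x]) [] (l e))"
    by (intro computable_intros assms computable_comp[OF f, of "\<lambda>p. (_ p, _ p)", simplified])
  ultimately show ?thesis by simp
qed

lemma computable_Ball [computable_intros]:
  assumes "computable l" and P: "computable (\<lambda>p. P (fst p) (snd p))"
  shows "computable (\<lambda>e. \<forall>x\<in>set (l e). P e x)"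
proof -
  have "foldl (\<lambda>b x. b \<and> P x) b xs \<longleftrightarrow> b \<and> (\<forall>x\<in>set xs. P x)" for P :: "'b \<Rightarrow> bool" and xs b
    by (induction xs arbitrary: b) auto
  moreover have "computable (\<lambda>e. foldl (\<lambda>b x. b \<and> P e x) True (l e))"
    by (intro computable_intros assms computable_comp[OF P, of "\<lambda>p. (_ p, _ p)", simplified])
  ultimately show ?thesis by simp
qed

lemma computable_Bex [computable_intros]:
  assumes "computable l" and P: "computable (\<lambda>p. P (fst p) (snd p))"
  shows "computable (\<lambda>e. \<exists>x\<in>set (l e). P e x)"
  using computable_not[OF computable_Ball[OF assms(1) computable_not[OF P]]] by simp

lemma computable_member [computable_intros]:
  assumes "computable x" "computable l"
  shows "computable (\<lambda>e. x e \<in> set (l e))"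
proof -
  have "computable (\<lambda>e. \<exists>y\<in>set (l e). x e = y)"
    by (intro computable_intros assms computable_comp[OF assms(1)])
  then show ?thesis by simp
qed

lemma computable_filter [computable_intros]:
  assumes "computable l" and P: "computable (\<lambda>p. P (fst p) (snd p))"
  shows "computable (\<lambda>e. filter (P e) (l e))"
proof -
  have "foldl (\<lambda>acc x. if P x then acc @ [x] else acc) ys xs = ys @ filter P xs"
    for P :: "'b \<Rightarrow> bool" and xs ys
    by (induction xs arbitrary: ys) auto
  moreover have "computable (\<lambda>e. foldl (\<lambda>acc x. if P e x then acc @ [x] else acc) [] (l e))"
    by (intro computable_intros assms computable_comp[OF P, of "\<lambda>p. (_ p, _ p)", simplified])
  ultimately show ?thesis by simp
qed

lemma computable_length [computable_intros]:
  assumes "computable l"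
  shows "computable (\<lambda>e. length (l e))"
proof -
  have "foldl (\<lambda>n x. Suc n) n xs = n + length xs" for n and xs :: "'b list"
    by (induction xs arbitrary: n) auto
  moreover have "computable (\<lambda>e. foldl (\<lambda>n x. Suc n) 0 (l e))"
    by (intro computable_intros assms)
  ultimately show ?thesis by simp
qed

lemma computable_drop [computable_intros]:
  assumes "computable n" "computable l"
  shows "computable (\<lambda>e. drop (n e) (l e))"
proof -
  have "(tl ^^ n) xs = drop n xs" for n and xs :: "'b list"
    by (induction n) (auto simp: drop_Suc tl_drop)
  moreover have "computable (\<lambda>e. (tl ^^ n e) (l e))"
    by (intro computable_intros assms)
  ultimately show ?thesis by simp
qed

lemma computable_take [computable_intros]:
  assumes "computable n" "computable l"
  shows "computable (\<lambda>e. take (n e) (l e))"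
proof -
  have "computable (\<lambda>e. rev (drop (length (l e) - n e) (rev (l e))))"
    by (intro computable_intros assms)
  moreover have "rev (drop (length xs - n) (rev xs)) = take n xs" for n and xs :: "'b list"
    by (cases "n \<le> length xs") (auto simp: rev_drop)
  ultimately show ?thesis by simp
qed

lemma computable_upt [computable_intros]:
  assumes "computable m" "computable n"
  shows "computable (\<lambda>e. [m e..<n e])"
proof -
  have "((\<lambda>xs. xs @ [m + length xs]) ^^ k) [] = [m..<m + k]" for m k
    by (induction k) auto
  moreover have "[m..<m + (n - m)] = [m..<n]" for m n :: nat
    by (cases "m \<le> n") auto
  moreover have "computable (\<lambda>e. ((\<lambda>xs. xs @ [m e + length xs]) ^^ (n e - m e)) [])"
    by (intro computable_intros assms computable_comp[OF assms(1)])
  ultimately show ?thesis by simp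
qed

lemma computable_replicate [computable_intros]:
  assumes "computable n" "computable x"
  shows "computable (\<lambda>e. replicate (n e) (x e))"
proof -
  have "computable (\<lambda>e. map (\<lambda>_. x e) [0..<n e])"
    by (intro computable_intros assms computable_comp[OF assms(2)])
  then show ?thesis by (simp add: map_replicate_const)
qed

lemma computable_all_less [computable_intros]:
  fixes n :: "_ \<Rightarrow> nat"
  assumes "computable n" "computable (\<lambda>p. P (fst p) (snd p))"
  shows "computable (\<lambda>e. \<forall>i<n e. P e i)"
  using computable_Ball[OF computable_upt[OF computable_const assms(1), of 0] assms(2)]
  by (simp add: atLeast0LessThan Ball_def)

lemma computable_ex_less [computable_intros]:
  fixes n :: "_ \<Rightarrow> nat"
  assumes "computable n" "computable (\<lambda>p. P (fst p) (snd p))"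
  shows "computable (\<lambda>e. \<exists>i<n e. P e i)"
  using computable_Bex[OF computable_upt[OF computable_const assms(1), of 0] assms(2)]
  by (simp add: atLeast0LessThan Bex_def)


section \<open>A universal semidecidable relation\<close>

text \<open>A semidecidable relation that dominates all others is obtained from Kleene's normal form: the
  witness for \<open>\<exists>m. R [n, m]\<close> is \<open>m\<close> together with a derivation of
  \<open>rec_eval p [n, m] 1\<close>, where \<open>p\<close> decides \<open>R\<close>. A derivation is a finite
  list of judgements, each of which follows by one rule of \<open>rec_eval\<close> from later entries of the
  list; being a derivation is decidable because all premises of the rules are searched for in that list.
  Even the rule for minimisation, whose premises are quantified over \<open>m < n\<close>, has only
  finitely many of them in each instance.

  Every term is coded by a triple: a tag for the constructor and two numbers for the arguments.\<close>

primrec recf_code :: "recf \<Rightarrow> nat" where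
  "recf_code Zero = code (0 :: nat, 0 :: nat, 0 :: nat)"
| "recf_code Succ = code (1 :: nat, 0 :: nat, 0 :: nat)"
| "recf_code (Proj i) = code (2 :: nat, i, 0 :: nat)"
| "recf_code (Comp f gs) = code (3 :: nat, recf_code f, code (map recf_code gs))"
| "recf_code (PrimRec f g) = code (4 :: nat, recf_code f, recf_code g)"
| "recf_code (Mu f) = code (5 :: nat, recf_code f, 0 :: nat)"

text \<open>A judgement \<open>(c, xs, y)\<close> states that the term with code \<open>c\<close> has value \<open>y\<close> at \<open>xs\<close>.\<close>

type_synonym judgement = "nat \<times> nat list \<times> nat"

text \<open>Unlike \<open>(!)\<close>, indexing with a default value is computable for all arguments.\<close>

definition nth_or_0 :: "nat list \<Rightarrow> nat \<Rightarrow> nat" where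
  "nth_or_0 xs i = (case drop i xs of [] \<Rightarrow> 0 | x # _ \<Rightarrow> x)"

lemma nth_or_0 [simp]: "i < length xs \<Longrightarrow> nth_or_0 xs i = xs ! i"
  by (simp add: nth_or_0_def flip: Cons_nth_drop_Suc)

lemma computable_nth_or_0 [computable_intros]:
  "computable l \<Longrightarrow> computable n \<Longrightarrow> computable (\<lambda>e. nth_or_0 (l e) (n e))"
  unfolding nth_or_0_def by (intro computable_intros)

text \<open>\<open>follows_by_rule D c t xs y\<close>: the judgement \<open>(c, xs, y)\<close>, in which \<open>c\<close>
  is the code of \<open>t\<close>, is the conclusion of a rule of \<open>rec_eval\<close> whose premises occur in
  \<open>D\<close>. The tags 0 to 5 stand for the constructors of \<open>recf\<close> in the order of their
  declaration. Everything is phrased with projections, decoding and bounded search, so that computability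
  can be read off syntactically.\<close>

definition follows_by_rule ::
  "judgement list \<Rightarrow> nat \<Rightarrow> nat \<times> nat \<times> nat \<Rightarrow> nat list \<Rightarrow> nat \<Rightarrow> bool" where
  "follows_by_rule D c t xs y \<longleftrightarrow>
     fst t = 0 \<and> y = 0 \<or>
     fst t = 1 \<and> 0 < y \<and> xs = [y - 1] \<or>
     fst t = 2 \<and> fst (snd t) < length xs \<and> y = nth_or_0 xs (fst (snd t)) \<or>
     fst t = 3 \<and> (\<exists>j\<in>set D. fst j = fst (snd t) \<and> snd (snd j) = y \<and>
       length (fst (snd j)) = length (decode (snd (snd t)) :: nat list) \<and>
       (\<forall>i<length (fst (snd j)).
         (nth_or_0 (decode (snd (snd t))) i, xs, nth_or_0 (fst (snd j)) i) \<in> set D)) \<or>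
     fst t = 4 \<and> (case xs of [] \<Rightarrow> False | n # zs \<Rightarrow>
       (case n of
          0 \<Rightarrow> (fst (snd t), zs, y) \<in> set D
        | Suc m \<Rightarrow> \<exists>j\<in>set D. fst j = c \<and> fst (snd j) = m # zs \<and>
            (snd (snd t), m # snd (snd j) # zs, y) \<in> set D)) \<or>
     fst t = 5 \<and> (fst (snd t), y # xs, 0) \<in> set D \<and>
       (\<forall>m<y. \<exists>j\<in>set D. fst j = fst (snd t) \<and> fst (snd j) = m # xs \<and> 0 < snd (snd j))"

definition justified :: "judgement list \<Rightarrow> judgement \<Rightarrow> bool" where
  "justified D j \<longleftrightarrow> follows_by_rule D (fst j) (decode (fst j)) (fst (snd j)) (snd (snd j))"

text \<open>The head of a derivation is its last step: each entry is justified by those behind it.\<close>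

definition derivation :: "judgement list \<Rightarrow> bool" where
  "derivation D \<longleftrightarrow> (\<forall>i<length D. case drop i D of [] \<Rightarrow> True | j # D' \<Rightarrow> justified D' j)"

lemma computable_justified [computable_intros]:
  assumes "computable D" "computable j"
  shows "computable (\<lambda>e. justified (D e) (j e))"
proof -
  have "computable (\<lambda>p. justified (fst p) (snd p))"
    unfolding justified_def follows_by_rule_def by (intro computable_intros)
  then show ?thesis
    using computable_comp[OF _ computable_Pair[OF assms]] by fastforce
qed

lemma computable_derivation [computable_intros]:
  assumes "computable D"
  shows "computable (\<lambda>e. derivation (D e))"
  unfolding derivation_def
  by (intro computable_intros assms computable_comp[OF assms])

lemma derivation_Nil [simp]: "derivation []"
  and derivation_Cons [simp]: "derivation (j # D) \<longleftrightarrow> justified D j \<and> derivation D"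
  by (simp_all add: derivation_def All_less_Suc2)

text \<open>The premises of a rule occur positively in \<open>follows_by_rule\<close>, so derivations can be
  concatenated.\<close>

lemma justified_mono:
  assumes "justified D j" "set D \<subseteq> set E"
  shows "justified E j"
proof -
  have sub: "i \<in> set E" if "i \<in> set D" for i using assms(2) that by blast
  from assms(1) show ?thesis
    unfolding justified_def follows_by_rule_def
    by (elim disj_forward; elim conj_forward)
      (blast intro: sub | simp split: list.splits nat.splits; blast intro: sub)+
qed

text \<open>On codes of actual terms, \<open>justified\<close> is the rule of \<open>rec_eval\<close> for the head
  constructor of the term.\<close>

lemma justified_code:
  "justified D (code t, xs, y) \<longleftrightarrow> follows_by_rule D (code t) t xs y"
  by (simp add: justified_def del: code_prod)

lemma Bex_triple: "(\<exists>j\<in>A. P (fst j) (fst (snd j)) (snd (snd j))) \<longleftrightarrow> (\<exists>a b c. (a, b, c) \<in> A \<and> P a b c)"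
  by force

lemma justified_Zero: "justified D (recf_code Zero, xs, y) \<longleftrightarrow> y = 0"
  unfolding recf_code.simps justified_code follows_by_rule_def by simp

lemma justified_Succ: "justified D (recf_code Succ, xs, y) \<longleftrightarrow> 0 < y \<and> xs = [y - 1]"
  unfolding recf_code.simps justified_code follows_by_rule_def by simp

lemma justified_Proj: "justified D (recf_code (Proj i), xs, y) \<longleftrightarrow> i < length xs \<and> y = xs ! i"
  unfolding recf_code.simps justified_code follows_by_rule_def by (simp cong: conj_cong)

lemma justified_Comp: "justified D (recf_code (Comp f gs), xs, y) \<longleftrightarrow>
    (\<exists>ys. (recf_code f, ys, y) \<in> set D \<and> list_all2 (\<lambda>g y. (recf_code g, xs, y) \<in> set D) gs ys)"
  unfolding recf_code.simps justified_code follows_by_rule_def list_all2_conv_all_nth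
  using Bex_triple[of "set D" "\<lambda>a b c. a = recf_code f \<and> c = y \<and> length b = length gs \<and>
      (\<forall>i<length gs. (recf_code (gs ! i), xs, b ! i) \<in> set D)"]
  by (simp cong: conj_cong) metis

lemma justified_PrimRec: "justified D (recf_code (PrimRec f g), xs, y) \<longleftrightarrow>
    (case xs of [] \<Rightarrow> False | n # zs \<Rightarrow>
      (case n of 0 \<Rightarrow> (recf_code f, zs, y) \<in> set D
       | Suc m \<Rightarrow> \<exists>r. (recf_code (PrimRec f g), m # zs, r) \<in> set D \<and>
           (recf_code g, m # r # zs, y) \<in> set D))"
  unfolding recf_code.simps justified_code follows_by_rule_def fst_conv snd_conv
    Bex_triple[where P = "\<lambda>a b c. a = _ \<and> b = _ \<and> (_, _ # c # _, y) \<in> set D"]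
  by (simp del: code_prod split: list.split nat.split)

lemma justified_Mu: "justified D (recf_code (Mu f), xs, y) \<longleftrightarrow>
    (recf_code f, y # xs, 0) \<in> set D \<and> (\<forall>m<y. \<exists>k. (recf_code f, m # xs, Suc k) \<in> set D)"
  unfolding recf_code.simps justified_code follows_by_rule_def fst_conv snd_conv
    Bex_triple[where P = "\<lambda>a b c. a = _ \<and> b = _ \<and> 0 < c"]
  by (simp add: gr0_conv_Suc) blast

declare recf_code.simps [simp del]

lemmas justified_simps = justified_Zero justified_Succ justified_Proj justified_Comp
  justified_PrimRec justified_Mu

lemma justified_imp_rec_eval:
  assumes "justified D (recf_code p, xs, y)"
    and D: "\<And>q zs z. (recf_code q, zs, z) \<in> set D \<Longrightarrow> rec_eval q zs z"
  shows "rec_eval p xs y"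
proof (cases p)
  case (Comp f gs)
  then obtain ys where "(recf_code f, ys, y) \<in> set D"
    and "list_all2 (\<lambda>g y. (recf_code g, xs, y) \<in> set D) gs ys"
    using assms(1) by (auto simp: justified_simps)
  then show ?thesis
    unfolding Comp by (intro rec_eval.comp[of xs gs ys]) (auto intro: D elim: list_all2_mono)
next
  case (PrimRec f g)
  show ?thesis
  proof (cases xs)
    case Nil
    then show ?thesis using assms(1) PrimRec by (simp add: justified_PrimRec)
  next
    case (Cons n zs)
    show ?thesis
    proof (cases n)
      case 0
      then have "rec_eval f zs y"
        using assms(1) PrimRec Cons by (intro D) (simp add: justified_PrimRec)
      then show ?thesis unfolding PrimRec Cons 0 by (rule rec_eval.primrec_0)
    next
      case (Suc m)
      then obtain r where "(recf_code (PrimRec f g), m # zs, r) \<in> set D" "(recf_code g, m # r # zs, y) \<in> set D"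
        using assms(1) PrimRec Cons by (auto simp: justified_PrimRec)
      then show ?thesis unfolding PrimRec Cons Suc by (intro rec_eval.primrec_Suc[of f g m zs r] D)
    qed
  qed
next
  case (Mu f)
  then have "(recf_code f, y # xs, 0) \<in> set D" "\<And>m. m < y \<Longrightarrow> \<exists>k. (recf_code f, m # xs, Suc k) \<in> set D"
    using assms(1) by (auto simp: justified_simps)
  then show ?thesis
    unfolding Mu by (intro rec_eval.mu) (blast intro: D)+
next
  case (Proj i)
  then show ?thesis using assms(1) by (auto simp: justified_Proj intro: rec_eval.proj)
next
  case Succ
  then show ?thesis using assms(1) by (auto simp: justified_Succ gr0_conv_Suc intro: rec_eval.succ)
next
  case Zero
  then show ?thesis using assms(1) by (auto simp: justified_Zero intro: rec_eval.zero)
qed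

lemma derivation_sound:
  "derivation D \<Longrightarrow> (recf_code p, xs, y) \<in> set D \<Longrightarrow> rec_eval p xs y"
proof (induction D arbitrary: p xs y)
  case (Cons j D)
  then show ?case by (auto intro: justified_imp_rec_eval)
qed simp

definition derivable :: "judgement \<Rightarrow> bool" where
  "derivable j \<longleftrightarrow> (\<exists>D. derivation D \<and> j \<in> set D)"

lemma derivation_append: "derivation D \<Longrightarrow> derivation E \<Longrightarrow> derivation (D @ E)"
  by (induction D) (auto elim: justified_mono)

text \<open>An instance of a rule may have several premises, with separate derivations; concatenation puts
  them into one list, from which the conclusion follows in one more step.\<close>

lemma finite_derivable:
  assumes "finite J" "\<And>j. j \<in> J \<Longrightarrow> derivable j"
  obtains D where "derivation D" "J \<subseteq> set D"
proof -
  have "\<exists>D. derivation D \<and> J \<subseteq> set D"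
    using assms
  proof (induction J)
    case empty
    show ?case by (intro exI[of _ "[]"]) simp
  next
    case (insert j J)
    then obtain D where D: "derivation D" "J \<subseteq> set D" by auto
    from insert.prems[of j] obtain E where "derivation E" "j \<in> set E"
      by (auto simp: derivable_def simp del: split_paired_All)
    with D show ?case by (intro exI[of _ "D @ E"]) (auto intro: derivation_append)
  qed
  then show thesis using that by blast
qed

lemma derivable_if_justified:
  assumes "justified D j" "\<And>i. i \<in> set D \<Longrightarrow> derivable i"
  shows "derivable j"
proof -
  obtain E where "derivation E" "set D \<subseteq> set E"
    using finite_derivable[of "set D"] assms(2) by auto
  then have "derivation (j # E)" using assms(1) by (auto elim: justified_mono)
  then show ?thesis unfolding derivable_def by (intro exI[of _ "j # E"]) simp
qed

lemma derivation_complete: "rec_eval p xs y \<Longrightarrow> derivable (recf_code p, xs, y)"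
proof (induction rule: rec_eval.induct)
  case (zero xs)
  show ?case by (rule derivable_if_justified[of "[]"]) (auto simp: justified_simps)
next
  case (succ x)
  show ?case by (rule derivable_if_justified[of "[]"]) (auto simp: justified_simps)
next
  case (proj i xs)
  show ?case
    by (rule derivable_if_justified[of "[]"]) (use proj in \<open>auto simp: justified_simps\<close>)
next
  case (comp xs gs ys f z)
  let ?D = "(recf_code f, ys, z) # map (\<lambda>p. (recf_code (fst p), xs, snd p)) (zip gs ys)"
  have len: "length gs = length ys" and args: "\<And>p. p \<in> set (zip gs ys) \<Longrightarrow> derivable (recf_code (fst p), xs, snd p)"
    using comp.IH(1) by (auto simp: list_all2_iff)
  show ?case
  proof (rule derivable_if_justified)
    have "(recf_code (gs ! i), xs, ys ! i) \<in> set ?D" if "i < length gs" for i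
    proof -
      have "(gs ! i, ys ! i) \<in> set (zip gs ys)" using that len by (auto simp: set_zip)
      then show ?thesis by (force simp: image_iff)
    qed
    then have "list_all2 (\<lambda>g y. (recf_code g, xs, y) \<in> set ?D) gs ys"
      using len by (intro list_all2_all_nthI) auto
    then show "justified ?D (recf_code (Comp f gs), xs, z)"
      unfolding justified_Comp by (intro exI[of _ ys]) simp
    show "derivable i" if "i \<in> set ?D" for i
      using that comp.IH(2) args by (simp only: list.set set_map insert_iff image_iff) blast
  qed
next
  case (primrec_0 f xs y g)
  show ?case
    by (rule derivable_if_justified[of "[(recf_code f, xs, y)]"])
      (use primrec_0 in \<open>auto simp: justified_simps\<close>)
next
  case (primrec_Suc f g n xs r y)
  let ?D = "[(recf_code (PrimRec f g), n # xs, r), (recf_code g, n # r # xs, y)]"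
  show ?case
    by (rule derivable_if_justified[of ?D])
      (use primrec_Suc in \<open>auto simp: justified_simps\<close>)
next
  case (mu f n xs)
  then obtain k where k: "\<And>m. m < n \<Longrightarrow> derivable (recf_code f, m # xs, Suc (k m))"
    by metis
  let ?D = "(recf_code f, n # xs, 0) # map (\<lambda>m. (recf_code f, m # xs, Suc (k m))) [0..<n]"
  show ?case
  proof (rule derivable_if_justified)
    have "(recf_code f, m # xs, Suc (k m)) \<in> set ?D" if "m < n" for m
      using that by (auto intro: image_eqI[where x = m])
    then show "justified ?D (recf_code (Mu f), xs, n)"
      unfolding justified_Mu by (intro conjI allI impI) (simp, blast)
    show "derivable i" if "i \<in> set ?D" for i
      using that mu.IH(1) k by auto
  qed
qed

text \<open>Here \<open>k\<close> codes a program \<open>c\<close> and an input \<open>n\<close>, and \<open>t\<close> codes a number \<open>m\<close>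
  and a derivation; the step succeeds if the derivation shows that \<open>c\<close> accepts \<open>[n, m]\<close>.\<close>

definition universal_step :: "nat \<Rightarrow> nat \<Rightarrow> bool" where
  "universal_step k t \<longleftrightarrow>
     derivation (snd (decode t :: nat \<times> judgement list)) \<and>
     (fst (decode k :: nat \<times> nat), [snd (decode k :: nat \<times> nat), fst (decode t :: nat \<times> judgement list)], 1)
       \<in> set (snd (decode t :: nat \<times> judgement list))"

lemma computable_universal_step [computable_intros]:
  assumes "computable k" "computable t"
  shows "computable (\<lambda>e. universal_step (k e) (t e))"
  unfolding universal_step_def by (intro computable_intros assms)

lemma universal_step_universal:
  assumes "sigma01 A"
  obtains c where "\<And>n. n \<in> A \<longleftrightarrow> (\<exists>t. universal_step (prod_encode (c, n)) t)"
proof -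
  obtain R where R: "recursive_pred 2 R" "A = {n. \<exists>m. R [n, m]}"
    using assms by (auto simp: sigma01_def)
  obtain p where p: "\<And>xs. length xs = 2 \<Longrightarrow> rec_eval p xs (of_bool (R xs))"
    using R(1) by (auto simp: recursive_pred_def recursive_fun_def)
  have R_iff: "R [n, m] \<longleftrightarrow> rec_eval p [n, m] 1" for n m
    using p[of "[n, m]"] rec_eval_deterministic[of p "[n, m]"] by (cases "R [n, m]") force+
  have dec: "decode (prod_encode (a, b)) = (a, b)" for a b :: nat
    using decode_code[of "(a, b)"] by simp
  have "n \<in> A \<longleftrightarrow> (\<exists>t. universal_step (prod_encode (recf_code p, n)) t)" for n
  proof
    assume "n \<in> A"
    then obtain m where "rec_eval p [n, m] 1" using R(2) R_iff by auto
    then obtain D where "derivation D" "(recf_code p, [n, m], 1) \<in> set D"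
      using derivation_complete unfolding derivable_def by blast
    then have "universal_step (prod_encode (recf_code p, n)) (code (m, D))"
      by (simp add: universal_step_def dec del: code_prod)
    then show "\<exists>t. universal_step (prod_encode (recf_code p, n)) t" ..
  next
    assume "\<exists>t. universal_step (prod_encode (recf_code p, n)) t"
    then show "n \<in> A"
      unfolding R(2) R_iff universal_step_def dec fst_conv snd_conv using derivation_sound by blast
  qed
  then show thesis by (rule that)
qed


section \<open>Words separated by growing spacers\<close>

text \<open>The words \<open>tower s n\<close> form a rank-one construction with spacer lengths \<open>s\<close>. The
  condition imposed on \<open>s\<close> is \<open>n \<le> s n\<close>, which leaves enough room to code arbitrary
  computable information in the lengths. It makes the spacers unbounded, so that the point
  \<open>\<lambda>_. 0\<close> belongs to the subshift, and it makes the language decidable when \<open>s\<close> is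
  computable.\<close>

primrec tower :: "(nat \<Rightarrow> nat) \<Rightarrow> nat \<Rightarrow> nat list" where
  "tower s 0 = [1]"
| "tower s (Suc n) = tower s n @ replicate (s n) 0 @ tower s n"

definition tower_language :: "(nat \<Rightarrow> nat) \<Rightarrow> nat list set" where
  "tower_language s = {u. \<exists>n. sublist u (tower s n)}"

definition tower_shift :: "(nat \<Rightarrow> nat) \<Rightarrow> (int \<Rightarrow> nat) set" where
  "tower_shift s = {x. \<forall>i j. map x [i..j] \<in> tower_language s}"

lemma length_tower: "n < length (tower s n)"
  by (induction n) auto

lemma set_tower: "set (tower s n) \<subseteq> {0, 1}"
  by (induction n) auto

lemma rev_tower: "rev (tower s n) = tower s n"
  by (induction n) auto

lemma tower_nonempty: "tower s n \<noteq> []"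
  using length_tower[of n s] by auto

lemma hd_tower: "hd (tower s n) = 1"
  by (induction n) (auto simp: tower_nonempty)

lemma last_tower: "last (tower s n) = 1"
  by (induction n) (auto simp: tower_nonempty)

lemma prefix_tower: "m \<le> n \<Longrightarrow> prefix (tower s m) (tower s n)"
proof (induction rule: dec_induct)
  case (step n)
  then show ?case by simp
qed simp

lemma suffix_tower: "m \<le> n \<Longrightarrow> suffix (tower s m) (tower s n)"
proof (induction rule: dec_induct)
  case (step n)
  then show ?case by (simp add: suffix_appendI)
qed simp

lemma sublist_tower: "m \<le> n \<Longrightarrow> sublist (tower s m) (tower s n)"
  by (simp add: prefix_tower)

lemma nth_tower:
  assumes "i < length (tower s m)" "i < length (tower s n)"
  shows "tower s m ! i = tower s n ! i"
proof -
  have *: "tower s m ! i = tower s n ! i" if "m \<le> n" "i < length (tower s m)" for m n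
    using prefix_tower[OF that(1), of s] that(2) by (auto simp: prefix_def nth_append)
  show ?thesis using *[OF _ assms(1)] *[OF _ assms(2)] by (metis nle_le)
qed

lemma tower_language_sublist:
  "u \<in> tower_language s \<Longrightarrow> sublist v u \<Longrightarrow> v \<in> tower_language s"
  unfolding tower_language_def using sublist_order.order_trans by blast


subsection \<open>Spacers can be read off the language\<close>

text \<open>The words begin and end with 1, so a maximal run of zeros between two ones lies inside one of
  the two copies of the previous word, or else is exactly the new spacer.\<close>

lemma gap_in_tower:
  "sublist (1 # replicate a 0 @ [1]) (tower s n) \<Longrightarrow> a \<in> range s"
proof (induction n)
  case 0
  then show ?case by (auto dest: sublist_length_le)
next
  case (Suc n)
  let ?u = "1 # replicate a 0 @ [1 :: nat]" and ?w = "tower s n"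
  have right: "a \<in> range s" if "sublist ?u (replicate (s n) 0 @ ?w)"
    using that unfolding sublist_append
  proof (elim disjE exE conjE)
    assume "sublist ?u (replicate (s n) 0)"
    then show ?thesis using set_mono_sublist[of ?u] by fastforce
  next
    fix x1 x2
    assume u: "?u = x1 @ x2" and x1: "suffix x1 (replicate (s n) 0)" and x2: "prefix x2 ?w"
    have "x1 = []"
    proof (rule ccontr)
      assume "x1 \<noteq> []"
      then have "1 \<in> set x1" using u by (cases x1) auto
      then show False using set_mono_suffix[OF x1] by fastforce
    qed
    then show ?thesis using Suc.IH u x2 by simp
  qed (use Suc.IH in blast)
  from Suc.prems show ?case
    unfolding tower.simps sublist_append[of _ ?w]
  proof (elim disjE exE conjE)
    fix x1 x2
    assume u: "?u = x1 @ x2" and x1: "suffix x1 ?w" and x2: "prefix x2 (replicate (s n) 0 @ ?w)"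
    show ?thesis
    proof (cases "x1 = [] \<or> x2 = []")
      case True
      then show ?thesis using right Suc.IH u x1 x2 by auto
    next
      case False
      then obtain ys zs where ys: "x1 = 1 # ys" and zs: "x2 = zs @ [1]"
        using u by (cases x1; cases x2 rule: rev_cases) auto
      have last: "last x1 = 1"
        using x1 False last_tower[of s n] by (auto simp: suffix_def)
      have yz: "ys @ zs = replicate a 0" using u ys zs by auto
      have "ys = []"
      proof (rule ccontr)
        assume "ys \<noteq> []"
        then have "last x1 \<in> set (ys @ zs)" using ys by simp
        then show False using last yz by auto
      qed
      then have "x2 = replicate a 0 @ [1]" using yz zs by simp
      then obtain r where r: "replicate (s n) 0 @ ?w = replicate a 0 @ 1 # r"
        using x2 by (auto simp: prefix_def)
      obtain w' where w': "?w = 1 # w'"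
        using hd_tower[of s n] tower_nonempty[of s n] by (cases ?w) auto
      have "takeWhile (\<lambda>x. x = 0) (replicate k 0 @ 1 # l) = replicate k (0 :: nat)" for k l
        by (induction k) auto
      from this[of "s n" w'] this[of a r] have "replicate (s n) 0 = replicate a (0 :: nat)"
        using r w' by simp
      then have "s n = a" by (metis length_replicate)
      then show ?thesis by auto
    qed
  qed (use Suc.IH right in blast)+
qed

lemma gap_in_tower_language:
  "1 # replicate a 0 @ [1] \<in> tower_language s \<longleftrightarrow> a \<in> range s"
proof
  assume "a \<in> range s"
  then obtain n where n: "a = s n" by auto
  obtain v where v: "tower s n = v @ [1]"
    using last_tower[of s n] tower_nonempty[of s n] by (metis append_butlast_last_id)
  obtain w where w: "tower s n = 1 # w"
    using hd_tower[of s n] tower_nonempty[of s n] by (metis list.collapse)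
  have "tower s (Suc n) = v @ (1 # replicate a 0 @ [1]) @ w"
    unfolding tower.simps n by (subst v, subst w) simp
  then show "1 # replicate a 0 @ [1] \<in> tower_language s"
    unfolding tower_language_def sublist_def by blast
qed (auto simp: tower_language_def intro: gap_in_tower)


subsection \<open>Deciding the language\<close>

text \<open>Words of length at most \<open>n\<close> see the spacers of all stages from \<open>n\<close> on as infinite:
  a factor of that length can only reach into the end of one copy of \<open>tower s n\<close> or into the beginning
  of the next one. So such a word belongs to the language if and only if it is a factor of
  \<open>tower s n\<close> padded with \<open>n\<close> zeros on both sides. The padded word itself
  occurs in \<open>tower s (n + 2)\<close>, around the second copy of \<open>tower s n\<close>.\<close>

lemma tower_language_padding:
  assumes "\<And>n. n \<le> s n"
  shows "replicate n 0 @ tower s n @ replicate n 0 \<in> tower_language s"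
proof -
  have *: "replicate (s m) 0 = replicate (s m - n) 0 @ replicate n (0 :: nat)"
    "replicate (s m) 0 = replicate n 0 @ replicate (s m - n) (0 :: nat)" if "n \<le> m" for m
    using that assms[of m] by (simp_all flip: replicate_add)
  let ?w = "tower s n"
  have "tower s (Suc (Suc n)) = ?w @ replicate (s n) 0 @ ?w @ replicate (s (Suc n)) 0 @ tower s (Suc n)"
    by simp
  also have "\<dots> = (?w @ replicate (s n - n) 0) @ (replicate n 0 @ ?w @ replicate n 0) @
      (replicate (s (Suc n) - n) 0 @ tower s (Suc n))"
    by (subst *(1)[of n], simp, subst *(2)[of "Suc n"]) simp_all
  finally show ?thesis unfolding tower_language_def sublist_def by blast
qed

lemma prefix_replicate: "k \<le> l \<Longrightarrow> prefix (replicate k x) (replicate l x)"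
  by (metis le_add_diff_inverse prefixI replicate_add)

lemma suffix_replicate: "k \<le> l \<Longrightarrow> suffix (replicate k x) (replicate l x)"
  using prefix_replicate by (metis suffix_to_prefix rev_replicate)

text \<open>Going down from a later stage: a factor that overlaps the spacer consists of zeros and a suffix
  or prefix of the neighbouring word, which is also a suffix or prefix of \<open>tower s (length u)\<close>,
  since that word is longer than \<open>u\<close>.\<close>

lemma sublist_padding:
  assumes "\<And>n. n \<le> s n" "sublist u (tower s n)"
  shows "sublist u (replicate (length u) 0 @ tower s (length u) @ replicate (length u) 0)"
    (is "sublist u ?pad")
proof (cases "n \<le> length u")
  case True
  then have "sublist u (tower s (length u))"
    using assms(2) sublist_tower sublist_order.order_trans by blast
  then show ?thesis
    unfolding sublist_append[of _ "replicate _ 0"] sublist_append[of _ "tower s _"] by blast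
next
  case False
  let ?L = "length u"
  have zeros: "sublist u ?pad" if "u = replicate k 0" for k
  proof -
    have "?pad = [] @ u @ tower s ?L @ u" using that by simp
    then show ?thesis unfolding sublist_def by blast
  qed
  have pre: "prefix x (tower s ?L)" if "prefix x (tower s m)" "length x \<le> ?L" "?L \<le> m" for x m
    using prefix_length_prefix[OF that(1) prefix_tower[OF that(3)]] that(2) length_tower[of ?L s]
    by simp
  have suf: "suffix x (tower s ?L)" if "suffix x (tower s m)" "length x \<le> ?L" "?L \<le> m" for x m
    using suffix_length_suffix[OF that(1) suffix_tower[OF that(3)]] that(2) length_tower[of ?L s]
    by simp
  from False have "?L \<le> n" by simp
  then show ?thesis using assms(2)
  proof (induction n rule: dec_induct)
    case base
    then show ?case unfolding sublist_append[of _ "replicate _ 0"] sublist_append[of _ "tower s _"] by blast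
  next
    case (step n)
    let ?w = "tower s n"
    have "?L \<le> s n" using step.hyps assms(1)[of n] by simp
    from step.prems show ?case
      unfolding tower.simps sublist_append[of _ ?w] sublist_append[of _ "replicate (s n) 0"]
    proof (elim disjE exE conjE)
      assume "sublist u (replicate (s n) 0)"
      then have "set u \<subseteq> {0}" using set_mono_sublist[of u "replicate (s n) 0"] by auto
      then have "u = replicate ?L 0" by (intro replicate_eqI) auto
      then show ?thesis by (rule zeros)
    next
      fix x1 x2
      assume u: "u = x1 @ x2" and x1: "suffix x1 (replicate (s n) 0)" and x2: "prefix x2 ?w"
      have "set x1 \<subseteq> {0}" using set_mono_suffix[OF x1] by auto
      then have "x1 = replicate (length x1) 0" by (intro replicate_eqI) auto
      moreover have "suffix (replicate (length x1) (0 :: nat)) (replicate ?L 0)"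
        by (rule suffix_replicate) (simp add: u)
      ultimately have "suffix x1 (replicate ?L 0)" by simp
      moreover have "prefix x2 (tower s ?L)" using pre[OF x2] u step.hyps by simp
      ultimately show ?thesis
        unfolding u sublist_append[of _ "replicate _ 0"] using prefix_prefix by blast
    next
      fix x1 x2
      assume u: "u = x1 @ x2" and x1: "suffix x1 ?w" and x2: "prefix x2 (replicate (s n) 0 @ ?w)"
      have "prefix x2 (replicate (s n) 0)"
        using x2 \<open>?L \<le> s n\<close> u by (auto simp: prefix_append)
      then have "set x2 \<subseteq> {0}" using set_mono_prefix[of x2 "replicate (s n) 0"] by auto
      then have "x2 = replicate (length x2) 0" by (intro replicate_eqI) auto
      moreover have "prefix (replicate (length x2) (0 :: nat)) (replicate ?L 0)"
        by (rule prefix_replicate) (simp add: u)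
      ultimately have "prefix x2 (replicate ?L 0)" by simp
      moreover have "suffix x1 (tower s ?L)" using suf[OF x1] u step.hyps by simp
      ultimately show ?thesis
        unfolding u sublist_append[of _ "replicate _ 0"] sublist_append[of _ "tower s _"] by blast
    qed (use step.IH in blast)+
  qed
qed

lemma tower_language_decision:
  assumes "\<And>n. n \<le> s n"
  shows "u \<in> tower_language s \<longleftrightarrow>
    sublist u (replicate (length u) 0 @ tower s (length u) @ replicate (length u) 0)"
    (is "_ \<longleftrightarrow> sublist u ?pad")
proof
  show "sublist u ?pad" if "u \<in> tower_language s"
    using that sublist_padding[of s u, OF assms] unfolding tower_language_def by blast
  show "u \<in> tower_language s" if "sublist u ?pad"
    using that tower_language_padding[of s "length u", OF assms] tower_language_sublist by blast
qed

lemma sublist_iff_take_drop: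
  "sublist u v \<longleftrightarrow> (\<exists>i<Suc (length v). take (length u) (drop i v) = u)"
proof
  assume "sublist u v"
  then obtain p q where "v = p @ u @ q" by (auto simp: sublist_def)
  then show "\<exists>i<Suc (length v). take (length u) (drop i v) = u"
    by (intro exI[of _ "length p"]) auto
next
  assume "\<exists>i<Suc (length v). take (length u) (drop i v) = u"
  then show "sublist u v"
    by (metis sublist_drop sublist_order.order_trans sublist_take)
qed

lemma computable_tower_language:
  assumes "computable s" "\<And>n. n \<le> s n"
  shows "computable (\<lambda>u. u \<in> tower_language s)"
proof -
  define step where "step p = (Suc (fst p), snd p @ replicate (s (fst p)) 0 @ snd p)"
    for p :: "nat \<times> nat list"
  have "(step ^^ n) (0, [1]) = (n, tower s n)" for n
    by (induction n) (auto simp: step_def)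
  moreover have "computable (\<lambda>n. snd ((step ^^ n) (0, [1])))"
    unfolding step_def by (intro computable_intros computable_comp[OF assms(1)])
  ultimately have tower: "computable (tower s)" by simp
  have "computable (\<lambda>u :: nat list. sublist u
      (replicate (length u) 0 @ tower s (length u) @ replicate (length u) 0))"
    unfolding sublist_iff_take_drop
    by (intro computable_intros computable_comp[OF tower])
  then show ?thesis by (simp add: tower_language_decision[OF assms(2)])
qed


subsection \<open>The language of the subshift\<close>

lemma sublist_map_upto:
  fixes x :: "int \<Rightarrow> 'a"
  assumes "a \<le> i" "j \<le> b"
  shows "sublist (map x [i..j]) (map x [a..b])"
proof (cases "i \<le> j")
  case True
  then have "[a..b] = [a..i - 1] @ [i..j] @ [j + 1..b]"
    using assms upto_split1[of a i b] upto_split2[of i j b] by simp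
  then show ?thesis by (auto simp: sublist_def)
qed simp

lemma nth_map_upto:
  fixes x :: "int \<Rightarrow> 'a"
  shows "int k \<le> j - i \<Longrightarrow> map x [i..j] ! k = x (i + int k)"
  by simp

lemma map_upto_eqI:
  fixes x :: "int \<Rightarrow> 'a"
  assumes "\<And>k. k < length u \<Longrightarrow> x (a + int k) = u ! k"
  shows "map x [a..a + int (length u) - 1] = u"
  using assms by (intro nth_equalityI) auto

lemma map_upto_sublistE:
  fixes x :: "int \<Rightarrow> 'a"
  assumes "sublist u (map x [a..b])"
  obtains i where "map x [i..i + int (length u) - 1] = u"
proof -
  obtain p q where pq: "map x [a..b] = p @ u @ q"
    using assms by (auto simp: sublist_def)
  have "x (a + int (length p) + int k) = u ! k" if "k < length u" for k
  proof -
    have len: "nat (b - a + 1) = length p + length u + length q"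
      using arg_cong[OF pq, of length] by simp
    have "(p @ u @ q) ! (length p + k) = u ! k" using that by (simp add: nth_append)
    then have "map x [a..b] ! (length p + k) = u ! k" by (simp only: pq)
    then show ?thesis using that len by (simp add: add.assoc)
  qed
  then show thesis using that map_upto_eqI by blast
qed

text \<open>The definition of \<open>tower_shift\<close> only bounds its language from above. The following point
  realises every word at once: to the left of 0 it is the left-infinite limit of the words
  \<open>tower s n\<close>, and to the right it is constantly 0. As the towers are palindromes, the
  left-infinite limit is the mirror image of the limit of prefixes, which has a simple formula; index
  \<open>- i\<close> of the tower is used because \<open>tower s m\<close> has more than \<open>m\<close> letters.\<close>

definition half_tower :: "(nat \<Rightarrow> nat) \<Rightarrow> int \<Rightarrow> nat" where
  "half_tower s i = (if i < 0 then tower s (nat (- i)) ! nat (- i - 1) else 0)"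

lemma map_half_tower:
  "map (half_tower s) [- int (length (tower s n))..int k - 1] = tower s n @ replicate k 0"
proof -
  let ?u = "tower s n @ replicate k 0" and ?l = "length (tower s n)"
  have "half_tower s (- int ?l + int i) = ?u ! i" if "i < length ?u" for i
  proof (cases "i < ?l")
    case True
    then have *: "nat (- (- int ?l + int i)) = ?l - i" "nat (- (- int ?l + int i) - 1) = ?l - Suc i"
      by auto
    have "half_tower s (- int ?l + int i) = tower s (?l - i) ! (?l - Suc i)"
      using True unfolding half_tower_def * by simp
    also have "\<dots> = tower s n ! (?l - Suc i)"
      using True length_tower[of "?l - i" s] by (intro nth_tower) auto
    also have "\<dots> = rev (tower s n) ! i" using True by (simp add: rev_nth)
    finally show ?thesis using True by (simp add: rev_tower nth_append)
  qed (use that in \<open>simp add: half_tower_def nth_append\<close>)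
  from map_upto_eqI[of ?u, OF this] show ?thesis by simp
qed

lemma tower_zeros_in_language:
  assumes "\<And>n. n \<le> s n"
  shows "tower s n @ replicate k 0 \<in> tower_language s"
proof -
  have "suffix (tower s n) (tower s (max n k))" by (simp add: suffix_tower)
  moreover have "prefix (replicate k 0) (replicate (max n k) (0 :: nat))"
    by (simp add: prefix_replicate)
  ultimately have "sublist (tower s n @ replicate k 0) (tower s (max n k) @ replicate (max n k) 0)"
    by (auto simp: sublist_append)
  also have "sublist \<dots> (replicate (max n k) 0 @ tower s (max n k) @ replicate (max n k) 0)"
    by simp
  finally show ?thesis
    using tower_language_sublist[OF tower_language_padding[OF assms]] by blast
qed

lemma half_tower_in_tower_shift:
  assumes "\<And>n. n \<le> s n"
  shows "half_tower s \<in> tower_shift s"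
  unfolding tower_shift_def mem_Collect_eq
proof (intro allI)
  fix i j
  define n k where "n = nat (- i)" and "k = nat (j + 1)"
  have "sublist (map (half_tower s) [i..j])
      (map (half_tower s) [- int (length (tower s n))..int k - 1])"
    using length_tower[of n s] by (intro sublist_map_upto) (auto simp: n_def k_def)
  then show "map (half_tower s) [i..j] \<in> tower_language s"
    unfolding map_half_tower
    using tower_language_sublist tower_zeros_in_language[OF assms] by blast
qed

lemma languageI: "x \<in> X \<Longrightarrow> map x [i..j] \<in> language X"
  by (auto simp: language_def)

lemma language_tower_shift:
  assumes "\<And>n. n \<le> s n"
  shows "language (tower_shift s) = tower_language s"
proof
  show "language (tower_shift s) \<subseteq> tower_language s"
    by (auto simp: language_def tower_shift_def)
  show "tower_language s \<subseteq> language (tower_shift s)"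
  proof
    fix u assume "u \<in> tower_language s"
    then obtain n where "sublist u (map (half_tower s) [- int (length (tower s n))..int 0 - 1])"
      unfolding map_half_tower by (auto simp: tower_language_def)
    then obtain i where "map (half_tower s) [i..i + int (length u) - 1] = u"
      by (rule map_upto_sublistE)
    then show "u \<in> language (tower_shift s)"
      using languageI[OF half_tower_in_tower_shift[OF assms]] by metis
  qed
qed


subsection \<open>Closed sets and subsystems\<close>

text \<open>A set is closed in the full shift if and only if it contains every point that its elements
  match on arbitrarily large windows around the origin.\<close>

lemma closedin_full_shift_iff:
  fixes X :: "(int \<Rightarrow> 'a) set"
  shows "closedin (product_topology (\<lambda>_. discrete_topology S) UNIV) X \<longleftrightarrow>
    X \<subseteq> UNIV \<rightarrow> S \<and>
    (\<forall>x. range x \<subseteq> S \<longrightarrow> (\<forall>n. \<exists>y\<in>X. \<forall>i. \<bar>i\<bar> \<le> n \<longrightarrow> y i = x i) \<longrightarrow> x \<in> X)"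
    (is "closedin ?T X \<longleftrightarrow> _ \<and> ?limits")
proof -
  have top: "topspace ?T = UNIV \<rightarrow> S" by (simp add: PiE_def)
  have "openin ?T (topspace ?T - X) \<longleftrightarrow> ?limits" if X: "X \<subseteq> UNIV \<rightarrow> S"
  proof
    assume op: "openin ?T (topspace ?T - X)"
    show ?limits
    proof (intro allI impI, rule ccontr)
      fix x
      assume x: "range x \<subseteq> S" and near: "\<forall>n. \<exists>y\<in>X. \<forall>i. \<bar>i\<bar> \<le> n \<longrightarrow> y i = x i" and "x \<notin> X"
      then have "x \<in> topspace ?T - X" by (auto simp: top)
      then obtain U where "finite {i \<in> UNIV. U i \<noteq> topspace (discrete_topology S)}"
        and U: "x \<in> Pi\<^sub>E UNIV U" "Pi\<^sub>E UNIV U \<subseteq> topspace ?T - X"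
        using op unfolding openin_product_topology_alt by blast
      then have fin: "finite {i. U i \<noteq> S}" by simp
      have n: "\<bar>i\<bar> \<le> Max (abs ` {i. U i \<noteq> S})" if "U i \<noteq> S" for i
        using fin that by (intro Max_ge) auto
      obtain y where y: "y \<in> X" "\<And>i. \<bar>i\<bar> \<le> Max (abs ` {i. U i \<noteq> S}) \<Longrightarrow> y i = x i"
        using near by blast
      have "y i \<in> U i" for i
      proof (cases "U i = S")
        case True
        then show ?thesis using X y(1) by auto
      next
        case False
        then have "y i = x i" by (intro y(2) n)
        then show ?thesis using PiE_mem[OF U(1), of i] by simp
      qed
      then have "y \<in> topspace ?T - X" using U(2) by (auto simp: PiE_def)
      then show False using y(1) by simp
    qed
  next
    assume lim: ?limits
    show "openin ?T (topspace ?T - X)"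
      unfolding openin_product_topology_alt
    proof
      fix x assume x: "x \<in> topspace ?T - X"
      then have "range x \<subseteq> S" "x \<notin> X" by (auto simp: top)
      with lim have "\<exists>n. \<not> (\<exists>y\<in>X. \<forall>i. \<bar>i\<bar> \<le> n \<longrightarrow> y i = x i)"
        unfolding not_all[symmetric] by iprover
      then obtain n where "\<not> (\<exists>y\<in>X. \<forall>i. \<bar>i\<bar> \<le> n \<longrightarrow> y i = x i)" ..
      then have n: "\<exists>i. \<bar>i\<bar> \<le> n \<and> y i \<noteq> x i" if "y \<in> X" for y using that by metis
      have intv: "{i :: int. \<bar>i\<bar> \<le> n} = {-n..n}" by auto
      have "finite {i :: int. \<bar>i\<bar> \<le> n}" unfolding intv by simp
      let ?U = "\<lambda>i. if \<bar>i\<bar> \<le> n then {x i} else S"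
      have "finite {i. ?U i \<noteq> S}"
        by (rule finite_subset[OF _ \<open>finite {i :: int. \<bar>i\<bar> \<le> n}\<close>]) auto
      moreover have "?U i \<subseteq> S" for i using x by (auto simp: top)
      moreover have "x \<in> Pi\<^sub>E UNIV ?U" using x by (auto simp: top)
      moreover have "Pi\<^sub>E UNIV ?U \<subseteq> topspace ?T - X"
      proof
        fix z assume z: "z \<in> Pi\<^sub>E UNIV ?U"
        have zU: "z i \<in> ?U i" for i using PiE_mem[OF z, of i] by simp
        moreover have "?U i \<subseteq> S" for i using x by (auto simp: top)
        ultimately have "z i \<in> S" for i by blast
        then have "z \<in> topspace ?T" unfolding top by blast
        moreover have "z i = x i" if "\<bar>i\<bar> \<le> n" for i using zU[of i] that by simp
        then have "z \<notin> X" using n by blast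
        ultimately show "z \<in> topspace ?T - X" by blast
      qed
      ultimately show "\<exists>U. finite {i \<in> UNIV. U i \<noteq> topspace (discrete_topology S)} \<and>
          (\<forall>i\<in>UNIV. openin (discrete_topology S) (U i)) \<and> x \<in> Pi\<^sub>E UNIV U \<and>
          Pi\<^sub>E UNIV U \<subseteq> topspace ?T - X"
        by (intro exI[of _ ?U] conjI ballI)
          (simp_all only: topspace_discrete_topology openin_discrete_topology UNIV_I simp_thms)
    qed
  qed
  then show ?thesis unfolding closedin_def top by blast
qed

lemma range_tower_shift: "x \<in> tower_shift s \<Longrightarrow> x i \<in> {0, 1}"
proof -
  assume "x \<in> tower_shift s"
  then have "map x [i..i] \<in> tower_language s" by (simp add: tower_shift_def del: upto_single)
  then obtain n where "sublist [x i] (tower s n)" by (auto simp: tower_language_def)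
  then show "x i \<in> {0, 1}" using set_mono_sublist[of "[x i]"] set_tower[of s n] by fastforce
qed

lemma map_shift_upto: "map (\<lambda>i. x (i + k)) [i..j] = map x [i + k..j + k]"
  for k :: int
  by (intro nth_equalityI) (auto simp: algebra_simps)

lemma subshift_tower_shift: "subshift {0, 1} (tower_shift s)"
  unfolding subshift_def closedin_full_shift_iff
proof (intro conjI allI impI)
  show "tower_shift s \<subseteq> UNIV \<rightarrow> {0, 1}" using range_tower_shift by blast
next
  fix x assume near: "\<forall>n. \<exists>y\<in>tower_shift s. \<forall>i. \<bar>i\<bar> \<le> n \<longrightarrow> y i = x i"
  show "x \<in> tower_shift s"
    unfolding tower_shift_def mem_Collect_eq
  proof (intro allI)
    fix i j :: int
    obtain y where y: "y \<in> tower_shift s" "\<And>k. \<bar>k\<bar> \<le> max \<bar>i\<bar> \<bar>j\<bar> \<Longrightarrow> y k = x k"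
      using near by blast
    have "map x [i..j] = map y [i..j]" using y(2) by (intro map_cong) auto
    moreover have "map y [i..j] \<in> tower_language s" using y(1) by (simp add: tower_shift_def)
    ultimately show "map x [i..j] \<in> tower_language s" by (simp only:)
  qed
next
  have *: "(\<lambda>i. x (i + k)) \<in> tower_shift s" if "x \<in> tower_shift s" for x and k :: int
    using that by (simp add: tower_shift_def map_shift_upto)
  show "shift ` tower_shift s = tower_shift s"
  proof (intro equalityI subsetI)
    fix x assume "x \<in> tower_shift s"
    then have "shift (\<lambda>i. x (i + - 1)) \<in> shift ` tower_shift s" by (intro imageI *)
    then show "x \<in> shift ` tower_shift s" by (simp add: shift_def)
  next
    fix x assume "x \<in> shift ` tower_shift s"
    then obtain y where "y \<in> tower_shift s" "x = shift y" by blast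
    then show "x \<in> tower_shift s" using *[of y 1] by (simp add: shift_def)
  qed
qed

lemma subshift_translate:
  assumes "subshift S Y" "y \<in> Y"
  shows "(\<lambda>i. y (i + k)) \<in> Y"
proof -
  have Y: "shift ` Y = Y" using assms(1) by (simp add: subshift_def)
  have up: "(\<lambda>i. z (i + 1)) \<in> Y" if "z \<in> Y" for z
    using imageI[OF that, of shift] unfolding Y by (simp add: shift_def)
  have down: "(\<lambda>i. z (i - 1)) \<in> Y" if "z \<in> Y" for z
  proof -
    from that have "z \<in> shift ` Y" unfolding Y .
    then obtain x where "x \<in> Y" "z = shift x" by blast
    then show ?thesis by (simp add: shift_def)
  qed
  show ?thesis
  proof (induction k rule: int_induct[of _ 0])
    case (step1 k)
    have "(\<lambda>i. y (i + 1 + k)) = (\<lambda>i. y (i + (k + 1)))" by (simp add: add.commute add.left_commute)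
    with up[OF step1(2)] show ?case by simp
  next
    case (step2 k)
    have "(\<lambda>i. y (i - 1 + k)) = (\<lambda>i. y (i + (k - 1)))" by (simp add: algebra_simps)
    with down[OF step2(2)] show ?case by simp
  qed (use assms(2) in simp)
qed

text \<open>Later towers are concatenations of copies of \<open>tower s n\<close> and zeros, so each of their
  ones lies in such a copy. This is the reason for quasiminimality: a point of the subshift that
  contains a 1 contains every tower, hence every word of the language, and its orbit is dense. A proper
  subsystem can only contain the point \<open>\<lambda>_. 0\<close>.\<close>

lemma one_lies_in_tower:
  assumes "n \<le> m" "i < length (tower s m)" "tower s m ! i = 1"
  shows "\<exists>q. q \<le> i \<and> i < q + length (tower s n) \<and> q + length (tower s n) \<le> length (tower s m) \<and>
    (\<forall>k<length (tower s n). tower s m ! (q + k) = tower s n ! k)"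
  using assms
proof (induction m arbitrary: i rule: dec_induct)
  case base
  then show ?case by (intro exI[of _ 0]) auto
next
  case (step m)
  let ?l = "length (tower s m)"
  have left: "tower s (Suc m) ! k = tower s m ! k" if "k < ?l" for k
    using that by (simp add: nth_append)
  have gap: "tower s (Suc m) ! k = 0" if "?l \<le> k" "k < ?l + s m" for k
  proof -
    have "k - ?l < s m" using that by simp
    then show ?thesis using that(1) by (simp add: nth_append)
  qed
  have right: "tower s (Suc m) ! (k + (?l + s m)) = tower s m ! k" for k
    by (simp add: nth_append)
  consider "i < ?l" | j where "i = j + (?l + s m)" "j < ?l"
  proof (cases "i < ?l + s m")
    case True
    then show thesis using that(1) gap[of i] step.prems(2) by linarith
  next
    case False
    then obtain j where "i = j + (?l + s m)" by (metis add.commute le_Suc_ex not_less)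
    then show thesis using that(2) step.prems(1) by simp
  qed
  then show ?case
  proof cases
    case 1
    then obtain q where q: "q \<le> i" "i < q + length (tower s n)" "q + length (tower s n) \<le> ?l"
      "\<forall>k<length (tower s n). tower s m ! (q + k) = tower s n ! k"
      using step.IH[of i] left[of i] step.prems(2) by auto
    have "tower s (Suc m) ! (q + k) = tower s n ! k" if "k < length (tower s n)" for k
      using left[of "q + k"] q that by simp
    with q show ?thesis by (intro exI[of _ q]) simp
  next
    case 2
    then obtain q where q: "q \<le> j" "j < q + length (tower s n)" "q + length (tower s n) \<le> ?l"
      "\<forall>k<length (tower s n). tower s m ! (q + k) = tower s n ! k"
      using step.IH[of j] right[of j] step.prems(2) by auto
    have "tower s (Suc m) ! (q + (?l + s m) + k) = tower s n ! k" if "k < length (tower s n)" for k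
      using right[of "q + k"] q(4) that by (simp only: ac_simps)
    with q 2 show ?thesis by (intro exI[of _ "q + (?l + s m)"]) simp
  qed
qed

lemma tower_occurs:
  assumes x: "x \<in> tower_shift s" and "x i = 1"
  obtains a where "map x [a..a + int (length (tower s n)) - 1] = tower s n"
proof -
  define l where "l = length (tower s n)"
  \<comment> \<open>The window around the given 1 is wide enough for any copy of the tower that covers it.\<close>
  let ?u = "map x [i - int l..i + int l]"
  have "?u \<in> tower_language s" using x by (simp add: tower_shift_def)
  then obtain m0 where "sublist ?u (tower s m0)" by (auto simp: tower_language_def)
  then have "sublist ?u (tower s (max n m0))"
    using sublist_tower[of m0 "max n m0" s] sublist_order.order_trans by fastforce
  then obtain m p r where "n \<le> m" and m: "tower s m = p @ ?u @ r"
    by (auto simp: sublist_def intro: that max.cobounded1)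
  have len: "length ?u = 2 * l + 1" by simp
  have u: "?u ! k = x (i - int l + int k)" if "k < 2 * l + 1" for k
    using that by (subst nth_map) auto
  have nth: "tower s m ! (length p + k) = x (i - int l + int k)" if "k < 2 * l + 1" for k
    unfolding m using that u[OF that] len by (simp add: nth_append del: length_map)
  have "tower s m ! (length p + l) = 1" using nth[of l] assms(2) by simp
  moreover have "length p + l < length (tower s m)" unfolding m by simp
  ultimately obtain q where q: "q \<le> length p + l" "length p + l < q + l"
    "\<And>k. k < l \<Longrightarrow> tower s m ! (q + k) = tower s n ! k"
    using one_lies_in_tower[OF \<open>n \<le> m\<close>] unfolding l_def by blast
  define d where "d = q - length p"
  have "x (i - int l + int d + int k) = tower s n ! k" if "k < l" for k
  proof -
    have "length p + (d + k) = q + k" using q(1,2) that unfolding d_def by simp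
    moreover have "d + k < 2 * l + 1" using q(1) that unfolding d_def by simp
    ultimately have "x (i - int l + int (d + k)) = tower s n ! k"
      using q(3)[OF that] nth[of "d + k"] by metis
    then show ?thesis by (simp add: add.assoc)
  qed
  then show thesis using that map_upto_eqI[of "tower s n" x] unfolding l_def by blast
qed

lemma subshift_eq_tower_shift:
  assumes Y: "subshift {0, 1} Y" "Y \<subseteq> tower_shift s" and y: "y \<in> Y" "y i \<noteq> 0"
  shows "tower_shift s \<subseteq> Y"
proof
  fix x assume x: "x \<in> tower_shift s"
  have ys: "y \<in> tower_shift s" using Y(2) y(1) by blast
  then have "y i = 1" using y(2) range_tower_shift[of y s i] by simp
  have "\<exists>z\<in>Y. \<forall>k. \<bar>k\<bar> \<le> n \<longrightarrow> z k = x k" for n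
  proof -
    let ?u = "map x [-n..n]"
    have "?u \<in> tower_language s" using x by (simp add: tower_shift_def)
    then obtain m where m: "sublist ?u (tower s m)" by (auto simp: tower_language_def)
    obtain a where "map y [a..a + int (length (tower s m)) - 1] = tower s m"
      using ys \<open>y i = 1\<close> by (rule tower_occurs)
    with m have "sublist ?u (map y [a..a + int (length (tower s m)) - 1])" by (simp only:)
    then obtain b where b: "map y [b..b + int (length ?u) - 1] = ?u"
      by (rule map_upto_sublistE)
    have "y (k + (b + n)) = x k" if "\<bar>k\<bar> \<le> n" for k
    proof -
      have "map y [b..b + int (length ?u) - 1] ! nat (k + n) = y (b + (k + n))"
        using that by (subst nth_map_upto) auto
      moreover have "?u ! nat (k + n) = x k"
        using that by (subst nth_map_upto) auto
      ultimately show ?thesis unfolding b by (simp add: algebra_simps)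
    qed
    then show ?thesis
      by (intro bexI[OF _ subshift_translate[OF Y(1) y(1), of "b + n"]] allI impI)
  qed
  then have near: "\<forall>n. \<exists>z\<in>Y. \<forall>k. \<bar>k\<bar> \<le> n \<longrightarrow> z k = x k" by (rule allI)
  have "range x \<subseteq> {0, 1}" by (rule image_subsetI) (rule range_tower_shift[OF x])
  then show "x \<in> Y"
    using Y(1) near unfolding subshift_def closedin_full_shift_iff by iprover
qed

lemma quasiminimal_tower_shift: "quasiminimal {0, 1} (tower_shift s)"
  unfolding quasiminimal_def
proof (rule finite_subset)
  show "{Y. subshift {0, 1} Y \<and> Y \<subset> tower_shift s} \<subseteq> Pow {\<lambda>_. 0}"
  proof (intro subsetI PowI)
    fix Y y
    assume "Y \<in> {Y. subshift {0, 1} Y \<and> Y \<subset> tower_shift s}" "y \<in> Y"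
    then have "y i = 0" for i using subshift_eq_tower_shift[of Y s y i] by blast
    then show "y \<in> {\<lambda>_. 0}" by auto
  qed
qed simp


section \<open>Automata reading off a residue class\<close>

text \<open>The automaton for gaps of length \<open>m\<close> modulo \<open>2 * m\<close>: the start state
  \<open>2 * m\<close> reads the first 1, the states below \<open>2 * m\<close> count zeros in a cycle, and state
  \<open>m\<close> may leave the cycle with the second 1 for the final state \<open>2 * m + 1\<close>.\<close>

definition gap_nfa :: "nat \<Rightarrow> nfa" where
  "gap_nfa m = NFA (2 * m + 2) (2 * m) [2 * m + 1]
     ((2 * m, 1, 0) # (m, 1, 2 * m + 1) #
       map (\<lambda>i. (i, 0, if Suc i = 2 * m then 0 else Suc i)) [0..<2 * m])"

lemma nfa_over_gap_nfa: "0 < m \<Longrightarrow> nfa_over {0, 1} (gap_nfa m)"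
  by (auto simp: nfa_over_def gap_nfa_def)

lemma gap_nfa_accepts_end: "0 < m \<Longrightarrow> nfa_accepts_from (gap_nfa m) (2 * m + 1) w \<longleftrightarrow> w = []"
  by (cases w) (auto simp: gap_nfa_def)

lemma gap_nfa_step:
  assumes "i < 2 * m"
  shows "(i, x, q) \<in> set (transitions (gap_nfa m)) \<longleftrightarrow>
    x = 1 \<and> i = m \<and> q = 2 * m + 1 \<or> x = 0 \<and> q = Suc i mod (2 * m)"
  using assms by (auto simp: gap_nfa_def mod_Suc)

lemma gap_nfa_accepts_cycle:
  "i < 2 * m \<Longrightarrow> nfa_accepts_from (gap_nfa m) i w \<longleftrightarrow>
    (\<exists>a. w = replicate a 0 @ [1] \<and> (i + a) mod (2 * m) = m)"
proof (induction w arbitrary: i)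
  case Nil
  then show ?case by (simp add: gap_nfa_def)
next
  case (Cons x w)
  have m: "0 < m" using Cons.prems by simp
  have IH: "nfa_accepts_from (gap_nfa m) (Suc i mod (2 * m)) w \<longleftrightarrow>
      (\<exists>a. w = replicate a 0 @ [1] \<and> (i + Suc a) mod (2 * m) = m)"
    using Cons.IH[of "Suc i mod (2 * m)"] m by (simp add: mod_add_left_eq)
  have "nfa_accepts_from (gap_nfa m) i (x # w) \<longleftrightarrow>
      x = 1 \<and> i = m \<and> w = [] \<or> x = 0 \<and> nfa_accepts_from (gap_nfa m) (Suc i mod (2 * m)) w"
    unfolding nfa_accepts_from.simps gap_nfa_step[OF Cons.prems]
    using gap_nfa_accepts_end[OF m] by blast
  also have "\<dots> \<longleftrightarrow> (\<exists>a. x # w = replicate a 0 @ [1] \<and> (i + a) mod (2 * m) = m)"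
  proof
    assume "x = 1 \<and> i = m \<and> w = [] \<or> x = 0 \<and> nfa_accepts_from (gap_nfa m) (Suc i mod (2 * m)) w"
    then show "\<exists>a. x # w = replicate a 0 @ [1] \<and> (i + a) mod (2 * m) = m"
    proof (elim disjE conjE)
      assume "x = 0" "nfa_accepts_from (gap_nfa m) (Suc i mod (2 * m)) w"
      then obtain a where "w = replicate a 0 @ [1]" "(i + Suc a) mod (2 * m) = m"
        unfolding IH by blast
      then show ?thesis using \<open>x = 0\<close> by (intro exI[of _ "Suc a"]) simp
    qed (use m in \<open>auto intro: exI[of _ 0]\<close>)
  next
    assume "\<exists>a. x # w = replicate a 0 @ [1] \<and> (i + a) mod (2 * m) = m"
    then obtain a where a: "x # w = replicate a 0 @ [1]" "(i + a) mod (2 * m) = m" by blast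
    show "x = 1 \<and> i = m \<and> w = [] \<or> x = 0 \<and> nfa_accepts_from (gap_nfa m) (Suc i mod (2 * m)) w"
    proof (cases a)
      case 0
      then show ?thesis using a Cons.prems by simp
    next
      case (Suc b)
      then show ?thesis using a unfolding IH by auto
    qed
  qed
  finally show ?case .
qed

lemma nfa_language_gap_nfa:
  assumes "0 < m"
  shows "nfa_language (gap_nfa m) = {1 # replicate a 0 @ [1] | a. a mod (2 * m) = m}"
proof -
  have start: "start (gap_nfa m) = 2 * m" by (simp add: gap_nfa_def)
  have step: "(2 * m, x, q) \<in> set (transitions (gap_nfa m)) \<longleftrightarrow> x = 1 \<and> q = 0" for x q
    using assms by (auto simp: gap_nfa_def)
  have "nfa_accepts_from (gap_nfa m) (2 * m) w \<longleftrightarrow>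
      (\<exists>a. w = 1 # replicate a 0 @ [1] \<and> a mod (2 * m) = m)" for w
  proof (cases w)
    case Nil
    then show ?thesis using assms by (simp add: gap_nfa_def)
  next
    case (Cons x v)
    then show ?thesis
      using gap_nfa_accepts_cycle[of 0 m v] assms by (auto simp: step)
  qed
  then show ?thesis unfolding nfa_language_def start by blast
qed

lemma computable_gap_nfa_code:
  assumes "computable f"
  shows "computable (\<lambda>e. nfa_code (gap_nfa (f e)))"
proof -
  have "nfa_code (gap_nfa m) = code [2 * m + 2, 2 * m, code [2 * m + 1],
      code (code [2 * m, 1, 0] # code [m, 1, 2 * m + 1] #
        map (\<lambda>i. code [i, 0, if Suc i = 2 * m then 0 else Suc i]) [0..<2 * m])]" for m
    by (simp add: nfa_code_def gap_nfa_def code_nat_list comp_def del: code_Cons code_Nil)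
  moreover have "computable (\<lambda>m. code [2 * m + 2, 2 * m, code [2 * m + 1],
      code (code [2 * m, 1, 0] # code [m, 1, 2 * m + 1] #
        map (\<lambda>i. code [i, 0, if Suc i = 2 * m then 0 else Suc i]) [0..<2 * m])])"
    by (intro computable_intros)
  ultimately have "computable (\<lambda>m. nfa_code (gap_nfa m))" by simp
  then show ?thesis using assms by (rule computable_comp)
qed


section \<open>Model checking is semidecidable\<close>

text \<open>Acceptance is decided by the subset construction, run along the word on lists of states. A
  witness that an automaton meets the language is then an accepted word that belongs to the language.
  Searching simultaneously for the components of the automaton avoids decoding the given number: it only
  has to be compared with the code of the components found.\<close>

definition nfa_step :: "(nat \<times> nat \<times> nat) list \<Rightarrow> nat list \<Rightarrow> nat \<Rightarrow> nat list" where
  "nfa_step T Q a =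
     map (\<lambda>t. snd (snd t)) (filter (\<lambda>t. fst t \<in> set Q \<and> fst (snd t) = a) T)"

lemma nfa_accepts_from_iff_foldl:
  "(\<exists>p\<in>set Q. nfa_accepts_from M p w) \<longleftrightarrow>
   (\<exists>p\<in>set (foldl (nfa_step (transitions M)) Q w). p \<in> set (final M))"
proof (induction w arbitrary: Q)
  case (Cons a w)
  have "(\<exists>p\<in>set Q. nfa_accepts_from M p (a # w)) \<longleftrightarrow>
      (\<exists>q\<in>set (nfa_step (transitions M) Q a). nfa_accepts_from M q w)"
    by (force simp: nfa_step_def)
  then show ?case using Cons.IH by simp
qed simp

type_synonym nfa_data = "nat \<times> nat \<times> nat list \<times> (nat \<times> nat \<times> nat) list"

definition nfa_of :: "nfa_data \<Rightarrow> nfa" where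
  "nfa_of d = NFA (fst d) (fst (snd d)) (fst (snd (snd d))) (snd (snd (snd d)))"

lemma surj_nfa_of: "\<exists>d. nfa_of d = M"
  by (intro exI[of _ "(num_states M, start M, final M, transitions M)"]) (simp add: nfa_of_def)

lemma computable_nfa_of_code: "computable (\<lambda>d. nfa_code (nfa_of d))"
proof -
  have "nfa_code (nfa_of d) = code [fst d, fst (snd d), code (fst (snd (snd d))),
      code (map (\<lambda>t. code [fst t, fst (snd t), snd (snd t)]) (snd (snd (snd d))))]" for d
    by (simp add: nfa_code_def nfa_of_def code_nat_list case_prod_unfold del: code_Cons code_Nil)
  moreover have "computable (\<lambda>d :: nfa_data. code [fst d, fst (snd d), code (fst (snd (snd d))),
      code (map (\<lambda>t. code [fst t, fst (snd t), snd (snd t)]) (snd (snd (snd d))))])"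
    by (intro computable_intros)
  ultimately show ?thesis by simp
qed

lemma computable_nfa_over: "computable (\<lambda>d. nfa_over {0, 1} (nfa_of d))"
proof -
  have "nfa_over {0, 1} (nfa_of d) \<longleftrightarrow> fst (snd d) < fst d \<and> (\<forall>p\<in>set (fst (snd (snd d))). p < fst d) \<and>
      (\<forall>t\<in>set (snd (snd (snd d))). fst t < fst d \<and> (fst (snd t) = 0 \<or> fst (snd t) = 1) \<and>
        snd (snd t) < fst d)" for d
    by (fastforce simp: nfa_over_def nfa_of_def)
  moreover have "computable (\<lambda>d :: nfa_data. fst (snd d) < fst d \<and> (\<forall>p\<in>set (fst (snd (snd d))). p < fst d) \<and>
      (\<forall>t\<in>set (snd (snd (snd d))). fst t < fst d \<and> (fst (snd t) = 0 \<or> fst (snd t) = 1) \<and>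
        snd (snd t) < fst d))"
    by (intro computable_intros)
  ultimately show ?thesis by simp
qed

lemma computable_nfa_language: "computable (\<lambda>p. snd p \<in> nfa_language (nfa_of (fst p)))"
proof -
  have "w \<in> nfa_language (nfa_of d) \<longleftrightarrow>
      (\<exists>q\<in>set (foldl (\<lambda>Q a. nfa_step (snd (snd (snd d))) Q a) [fst (snd d)] w). q \<in> set (fst (snd (snd d))))"
    for w d
    using nfa_accepts_from_iff_foldl[of "[start (nfa_of d)]" "nfa_of d" w]
    by (simp add: nfa_language_def) (simp add: nfa_of_def)
  moreover have "computable (\<lambda>p :: nfa_data \<times> nat list. \<exists>q\<in>set (foldl (\<lambda>Q a. nfa_step (snd (snd (snd (fst p)))) Q a)
      [fst (snd (fst p))] (snd p)). q \<in> set (fst (snd (snd (fst p)))))"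
    unfolding nfa_step_def by (intro computable_intros)
  ultimately show ?thesis by simp
qed

lemma recursive_pred_2I:
  assumes "computable (\<lambda>p. P (fst p) (snd p))"
  shows "recursive_pred 2 (\<lambda>xs. P (xs ! 0) (xs ! 1))"
proof -
  obtain p where p: "\<And>m n. rec_eval p [prod_encode (m, n)] (of_bool (P m n))"
    using assms by (elim computableE) fastforce
  obtain r where r: "\<And>m n. rec_eval r [m, n] (prod_encode (m, n))" using ex_rec_prod_encode by blast
  have "rec_eval (Comp p [r]) xs (of_bool (P (xs ! 0) (xs ! 1)))" if len: "length xs = 2" for xs
  proof -
    obtain m n where "xs = [m, n]" using len by (auto simp: length_Suc_conv numeral_2_eq_2)
    then show ?thesis using rec_eval_Comp1[OF r p] by simp
  qed
  then show ?thesis unfolding recursive_pred_def recursive_fun_def by blast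
qed

lemma recursive_fun_1I:
  assumes "computable f"
  shows "recursive_fun 1 (\<lambda>xs. f (xs ! 0))"
proof -
  obtain p where p: "\<And>n. rec_eval p [n] (f n)"
    using assms unfolding computable_def by auto
  have "rec_eval p xs (f (xs ! 0))" if "length xs = 1" for xs
    using that p by (auto simp: length_Suc_conv)
  then show ?thesis unfolding recursive_fun_def by blast
qed

lemma recursive_languageI:
  assumes "computable (\<lambda>u. u \<in> W)"
  shows "recursive_language W"
proof -
  obtain p where p: "\<And>u. rec_eval p [code u] (code (u \<in> W))"
    using assms unfolding computable_def by blast
  have "rec_eval p [n] (of_bool (n \<in> list_encode ` W))" for n
  proof -
    have "n \<in> list_encode ` W \<longleftrightarrow> list_decode n \<in> W"
      by (metis image_iff list_decode_inverse list_encode_inverse)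
    then show ?thesis using p[of "list_decode n"] by (simp add: code_nat_list)
  qed
  then have "computable (\<lambda>n. n \<in> list_encode ` W)" by (intro computableI[of p]) simp
  then have "computable (\<lambda>n. of_bool (n \<in> list_encode ` W) :: nat)" by (rule computable_recode) simp
  then show ?thesis
    unfolding recursive_language_def recursive_set_def recursive_pred_def by (rule recursive_fun_1I)
qed

lemma sigma01_model_checking_problem:
  assumes "computable (\<lambda>u. u \<in> language X)"
  shows "sigma01 (model_checking_problem {0, 1} X)"
  unfolding sigma01_def
proof (intro exI conjI)
  let ?R = "\<lambda>n m. (\<lambda>p :: nfa_data \<times> nat list. nfa_code (nfa_of (fst p)) = n \<and> nfa_over {0, 1} (nfa_of (fst p)) \<and>
    snd p \<in> language X \<and> snd p \<in> nfa_language (nfa_of (fst p))) (decode m)"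
  have "computable (\<lambda>q. ?R (fst q) (snd q))"
    by (intro computable_intros computable_comp[OF computable_nfa_of_code]
        computable_comp[OF computable_nfa_over] computable_comp[OF assms]
        computable_comp[OF computable_nfa_language])
  then show "recursive_pred 2 (\<lambda>xs. ?R (xs ! 0) (xs ! 1))" by (rule recursive_pred_2I)
  show "model_checking_problem {0, 1} X = {n. \<exists>m. ?R ([n, m] ! 0) ([n, m] ! 1)}"
  proof (intro equalityI subsetI)
    fix n assume "n \<in> model_checking_problem {0, 1} X"
    then obtain M u where "n = nfa_code M" "nfa_over {0, 1} M" "u \<in> language X" "u \<in> nfa_language M"
      by (auto simp: model_checking_problem_def)
    moreover obtain d where "nfa_of d = M" using surj_nfa_of by blast
    ultimately have "?R n (code (d, u))" by (simp del: code_prod)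
    then have "\<exists>m. ?R n m" ..
    then show "n \<in> {n. \<exists>m. ?R ([n, m] ! 0) ([n, m] ! 1)}" by simp
  next
    fix n assume "n \<in> {n. \<exists>m. ?R ([n, m] ! 0) ([n, m] ! 1)}"
    then obtain m where "?R n m" by auto
    then show "n \<in> model_checking_problem {0, 1} X"
      unfolding model_checking_problem_def by blast
  qed
qed


section \<open>The universal subshift\<close>

text \<open>The exponent of 2 in the spacer of stage \<open>a\<close> reports on the computation step \<open>(k, t)\<close>
  coded by \<open>a\<close>: it is \<open>k + 1\<close> if the step succeeds, and 0, the same for all \<open>k\<close>, if it
  fails. The odd factor \<open>2 * a + 1\<close> ensures growth. Exponents can be tested by finite automata, as
  exponent \<open>d\<close> means residue \<open>2 ^ d\<close> modulo \<open>2 ^ (d + 1)\<close>; so a single automaton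
  asks whether some step of the \<open>k\<close>-th computation succeeds.\<close>

definition halting_spacer :: "nat \<Rightarrow> nat" where
  "halting_spacer a =
     2 ^ (if universal_step (fst (decode a :: nat \<times> nat)) (snd (decode a :: nat \<times> nat))
          then Suc (fst (decode a :: nat \<times> nat)) else 0) * (2 * a + 1)"

lemma computable_halting_spacer: "computable halting_spacer"
proof -
  have "computable (\<lambda>a. halting_spacer a)"
    unfolding halting_spacer_def by (intro computable_intros)
  then show ?thesis .
qed

lemma le_halting_spacer: "a \<le> halting_spacer a"
proof -
  have "1 * a \<le> 2 ^ e * (2 * a + 1)" for e :: nat
    by (rule mult_le_mono) auto
  then show ?thesis unfolding halting_spacer_def by simp
qed

lemma power_2_odd_mod:
  "(2 ^ e * (2 * a + 1)) mod (2 * 2 ^ d) = 2 ^ d \<longleftrightarrow> e = d" for a :: nat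
proof
  assume mod: "(2 ^ e * (2 * a + 1)) mod (2 * 2 ^ d) = (2 ^ d :: nat)"
  define b where "b = (2 ^ e * (2 * a + 1)) div (2 * 2 ^ d)"
  have eq: "2 ^ e * (2 * a + 1) = 2 ^ d * (2 * b + 1)"
    using div_mult_mod_eq[of "2 ^ e * (2 * a + 1)" "2 * 2 ^ d"] mod
    by (simp add: b_def algebra_simps)
  have *: False if "e < d" "2 ^ e * (2 * a + 1) = 2 ^ d * (2 * b + 1)" for a b :: nat and e d
  proof -
    obtain k where "d = e + Suc k" using \<open>e < d\<close> less_imp_Suc_add by auto
    then have "2 ^ e * (2 * a + 1) = 2 ^ e * (2 * (2 ^ k * (2 * b + 1)))"
      using that(2) by (simp only: power_add power_Suc mult.assoc)
    then have "2 * a + 1 = 2 * (2 ^ k * (2 * b + 1))"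
      by (subst (asm) mult_cancel_left) simp
    then show False by presburger
  qed
  show "e = d" using *[of e d a b] *[of d e b a] eq by (cases e d rule: linorder_cases) auto
next
  assume "e = d"
  then show "(2 ^ e * (2 * a + 1)) mod (2 * 2 ^ d) = 2 ^ d"
    by (simp add: algebra_simps)
qed

lemma halting_spacer_mod:
  "(\<exists>a\<in>range halting_spacer. a mod (2 * 2 ^ Suc k) = 2 ^ Suc k) \<longleftrightarrow> (\<exists>t. universal_step k t)"
proof
  assume "\<exists>a\<in>range halting_spacer. a mod (2 * 2 ^ Suc k) = 2 ^ Suc k"
  then obtain a where "halting_spacer a mod (2 * 2 ^ Suc k) = 2 ^ Suc k" by blast
  then show "\<exists>t. universal_step k t"
    unfolding halting_spacer_def power_2_odd_mod by (auto split: if_splits)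
next
  assume "\<exists>t. universal_step k t"
  then obtain t where t: "universal_step k t" ..
  have "halting_spacer (code (k, t)) mod (2 * 2 ^ Suc k) = 2 ^ Suc k"
    unfolding halting_spacer_def decode_code power_2_odd_mod using t by simp
  then show "\<exists>a\<in>range halting_spacer. a mod (2 * 2 ^ Suc k) = 2 ^ Suc k" by blast
qed

theorem theorem2:
  "\<exists>(S :: nat set) (X :: (int \<Rightarrow> nat) set).
     finite S \<and> subshift S X \<and> recursive_subshift X \<and> universal_subshift S X \<and> quasiminimal S X"
proof (intro exI conjI)
  let ?S = "{0, 1} :: nat set" and ?X = "tower_shift halting_spacer"
  note lang = language_tower_shift[of halting_spacer, OF le_halting_spacer]
  have decidable: "computable (\<lambda>u. u \<in> language ?X)"
    unfolding lang by (rule computable_tower_language[OF computable_halting_spacer le_halting_spacer])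
  show "finite ?S" by simp
  show "subshift ?S ?X" by (rule subshift_tower_shift)
  show "quasiminimal ?S ?X" by (rule quasiminimal_tower_shift)
  show "recursive_subshift ?X"
    unfolding recursive_subshift_def by (rule recursive_languageI[OF decidable])
  have MC: "nfa_code (gap_nfa (2 ^ Suc k)) \<in> model_checking_problem ?S ?X \<longleftrightarrow> (\<exists>t. universal_step k t)"
    for k
  proof -
    have "nfa_code (gap_nfa (2 ^ Suc k)) \<in> model_checking_problem ?S ?X \<longleftrightarrow>
        language ?X \<inter> nfa_language (gap_nfa (2 ^ Suc k)) \<noteq> {}"
      unfolding model_checking_problem_def inj_image_mem_iff[OF inj_nfa_code]
      using nfa_over_gap_nfa[of "2 ^ Suc k"] by simp
    also have "\<dots> \<longleftrightarrow> (\<exists>a. 1 # replicate a 0 @ [1] \<in> tower_language halting_spacer \<and>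
        a mod (2 * 2 ^ Suc k) = 2 ^ Suc k)"
      unfolding lang nfa_language_gap_nfa[OF zero_less_power[OF pos2]] by blast
    also have "\<dots> \<longleftrightarrow> (\<exists>t. universal_step k t)"
      unfolding gap_in_tower_language halting_spacer_mod[symmetric] by blast
    finally show ?thesis .
  qed
  have "many_one_reducible A (model_checking_problem ?S ?X)" if "sigma01 A" for A
  proof -
    obtain c where c: "\<And>n. n \<in> A \<longleftrightarrow> (\<exists>t. universal_step (prod_encode (c, n)) t)"
      using universal_step_universal[OF \<open>sigma01 A\<close>] by blast
    have "computable (\<lambda>n :: nat. nfa_code (gap_nfa (2 ^ Suc (code (c, n)))))"
      by (intro computable_gap_nfa_code computable_intros)
    then have "recursive_fun 1 (\<lambda>xs. nfa_code (gap_nfa (2 ^ Suc (prod_encode (c, xs ! 0)))))"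
      by (intro recursive_fun_1I) (simp only: code_prod code_nat fst_conv snd_conv)
    then show ?thesis
      unfolding many_one_reducible_def using c MC
      by (intro exI[of _ "\<lambda>n. nfa_code (gap_nfa (2 ^ Suc (prod_encode (c, n))))"]) blast
  qed
  then show "universal_subshift ?S ?X"
    unfolding universal_subshift_def sigma01_complete_def
    using sigma01_model_checking_problem[OF decidable] by blast
qed

end
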